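(* Let $m\ge 2$ and $n\ge 3$. With all algebras realized inside $L_{\widehat{\mathfrak{so}}_{2mn}}(1,0)$ as in the context and $G=\langle\sigma_1,\dots,\sigma_n\rangle$, one has $L_{\widehat{\mathfrak{so}}_{2m}}(n,0)\subseteq L_{\widehat{\mathfrak{so}}_{2mn}}(1,0)^{G}$ and $$L_{\widehat{\mathfrak{so}}_{2mn}}(1,0)^{G}=L^{(1)}_{\widehat{\mathfrak{so}}_{2m}}(1,0)\otimes L^{(2)}_{\widehat{\mathfrak{so}}_{2m}}(1,0)\otimes\cdots\otimes L^{(n)}_{\widehat{\mathfrak{so}}_{2m}}(1,0).$$
   Context: $L_{\widehat{\mathfrak{so}}_r}(k,0)$ is the simple affine vertex operator algebra of level $k$ attached to $\mathfrak{so}_r(\mathbb C)$. Fermionic realization: let $\mathcal F_{2mn}$ be the irreducible module, generated by a vector $\mathbf 1$ with $\psi_{ki}(r)\mathbf 1=0$ for $r>0$, over the Clifford algebra with generators $\psi_{ki}(r)$ ($1\le k\le 2m$, $1\le i\le n$, $r\in\mathbb Z+\frac12$) and relations $\psi_{ki}(r)\psi_{lj}(s)+\psi_{lj}(s)\psi_{ki}(r)=\delta_{kl}\delta_{ij}\delta_{r+s,0}$. It is a simple vertex superalgebra generated by the fields $\psi_{ki}(z)=\sum_{r\in\mathbb Z}\psi_{ki}(r+\frac12)z^{-r-1}$, and its even part is identified with $L_{\widehat{\mathfrak{so}}_{2mn}}(1,0)$; it is generated by the vectors $\psi_{kj}(-\frac12)\psi_{rs}(-\frac12)\mathbf 1$.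 Inside it: - For $1\le j\le n$, the vertex subalgebra $L^{(j)}_{\widehat{\mathfrak{so}}_{2m}}(1,0)\cong L_{\widehat{\mathfrak{so}}_{2m}}(1,0)$ is generated by $\psi_{kj}(-\frac12)\psi_{lj}(-\frac12)\mathbf 1$, $1\le k,l\le 2m$; these subalgebras mutually commute and generate a copy of their tensor product. - $L_{\widehat{\mathfrak{so}}_{2m}}(n,0)$ denotes the (diagonal) vertex subalgebra generated by $\sum_{j=1}^n\psi_{kj}(-\frac12)\psi_{lj}(-\frac12)\mathbf 1$, $1\le k,l\le 2m$. For $1\le i\le n$, $\sigma_i$ is the automorphism of $L_{\widehat{\mathfrak{so}}_{2mn}}(1,0)$ of order at most two determined by $\sigma_i(\psi_{kj}(-\frac12)\psi_{rs}(-\frac12)\mathbf 1)=(-1)^{\delta_{ij}+\delta_{is}}\psi_{kj}(-\frac12)\psi_{rs}(-\frac12)\mathbf 1$ for $1\le k,r\le 2m$, $1\le j,s\le n$. $(\cdot)^G$ denotes $G$-fixed points. *)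

theory Defs
  imports Complex_Main "HOL-Library.FuncSet" "HOL-Library.Groups_Big_Fun"
    "HOL-Algebra.Bij" "HOL-Algebra.Generated_Groups"
begin

section \<open>Vertex superalgebras\<close>

text \<open>
  \<open>mode V a p\<close> is the mode \<open>a\<^sub>(\<^sub>p\<^sub>)\<close> in \<open>Y(a,z) = \<Sum>\<^sub>p a\<^sub>(\<^sub>p\<^sub>) z\<^bsup>-p-1\<^esup>\<close>.  The underlying vector space is the
  whole type \<open>'v\<close>; subalgebras are sets.
\<close>

record 'v vertex_data =
  smul :: "complex \<Rightarrow> 'v \<Rightarrow> 'v"
  vac :: "'v"
  mode :: "'v \<Rightarrow> int \<Rightarrow> 'v \<Rightarrow> 'v"
  even_part :: "'v set"
  odd_part :: "'v set"

definition parity_sign :: "'v vertex_data \<Rightarrow> 'v \<Rightarrow> 'v \<Rightarrow> complex" where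
  "parity_sign V a b = (if a \<in> odd_part V \<and> b \<in> odd_part V then -1 else 1)"

text \<open>
  The last axiom is the Jacobi identity in components (the Borcherds identity).  By the truncation
  axiom all sums over \<open>i \<ge> 0\<close> occurring in it have only finitely many nonzero terms, so that
  \<open>Sum_any\<close> is the actual sum.  The translation operator is \<open>a \<mapsto> a\<^sub>(\<^sub>-\<^sub>2\<^sub>) vac\<close> and its properties
  follow from the axioms.
\<close>

locale vertex_superalgebra = vector_space "smul V"
  for V :: "'v::ab_group_add vertex_data" +
  assumes even_subspace: "module.subspace (smul V) (even_part V)"
    and odd_subspace: "module.subspace (smul V) (odd_part V)"
    and even_Int_odd: "even_part V \<inter> odd_part V = {0}"
    and even_plus_odd: "\<exists>x\<in>even_part V. \<exists>y\<in>odd_part V. v = x + y"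
    and vac_even: "vac V \<in> even_part V"
    and mode_linear_left: "Vector_Spaces.linear (smul V) (smul V) (\<lambda>a. mode V a p b)"
    and mode_linear_right: "Vector_Spaces.linear (smul V) (smul V) (mode V a p)"
    and mode_even_even:
      "\<lbrakk>a \<in> even_part V; b \<in> even_part V\<rbrakk> \<Longrightarrow> mode V a p b \<in> even_part V"
    and mode_even_odd:
      "\<lbrakk>a \<in> even_part V; b \<in> odd_part V\<rbrakk> \<Longrightarrow> mode V a p b \<in> odd_part V"
    and mode_odd_even:
      "\<lbrakk>a \<in> odd_part V; b \<in> even_part V\<rbrakk> \<Longrightarrow> mode V a p b \<in> odd_part V"
    and mode_odd_odd:
      "\<lbrakk>a \<in> odd_part V; b \<in> odd_part V\<rbrakk> \<Longrightarrow> mode V a p b \<in> even_part V"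
    and truncation: "\<exists>N. \<forall>p\<ge>N. mode V a p b = 0"
    and vacuum: "mode V (vac V) p b = (if p = -1 then b else 0)"
    and creation: "mode V a (-1) (vac V) = a"
    and creation_regular: "p \<ge> 0 \<Longrightarrow> mode V a p (vac V) = 0"
    and borcherds:
      "\<lbrakk>a \<in> even_part V \<union> odd_part V; b \<in> even_part V \<union> odd_part V\<rbrakk> \<Longrightarrow>
       Sum_any (\<lambda>i::nat. smul V (of_int p gchoose i)
           (mode V (mode V a (r + int i) b) (p + q - int i) c))
       = Sum_any (\<lambda>i::nat. smul V ((-1) ^ i * (of_int r gchoose i))
           (mode V a (p + r - int i) (mode V b (q + int i) c)
            - smul V (parity_sign V a b * (-1) powi r)
                (mode V b (q + r - int i) (mode V a (p + int i) c))))"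

definition vertex_subalgebra :: "'v::ab_group_add vertex_data \<Rightarrow> 'v set \<Rightarrow> bool" where
  "vertex_subalgebra V U \<longleftrightarrow>
     module.subspace (smul V) U \<and> vac V \<in> U \<and> (\<forall>a\<in>U. \<forall>b\<in>U. \<forall>p. mode V a p b \<in> U)"

definition generated_subalgebra :: "'v::ab_group_add vertex_data \<Rightarrow> 'v set \<Rightarrow> 'v set" where
  "generated_subalgebra V S = \<Inter>{U. vertex_subalgebra V U \<and> S \<subseteq> U}"

text \<open>As in \<open>Bij\<close>, automorphisms of \<open>U\<close> are \<open>undefined\<close> outside \<open>U\<close>.\<close>

definition vertex_automorphisms :: "'v::ab_group_add vertex_data \<Rightarrow> 'v set \<Rightarrow> ('v \<Rightarrow> 'v) set" where
  "vertex_automorphisms V U = {f \<in> Bij U.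
     (\<forall>a\<in>U. \<forall>b\<in>U. f (a + b) = f a + f b) \<and>
     (\<forall>c. \<forall>a\<in>U. f (smul V c a) = smul V c (f a)) \<and>
     f (vac V) = vac V \<and>
     (\<forall>a\<in>U. \<forall>b\<in>U. \<forall>p. f (mode V a p b) = mode V (f a) p (f b))}"

definition vertex_aut_group :: "'v::ab_group_add vertex_data \<Rightarrow> 'v set \<Rightarrow> ('v \<Rightarrow> 'v) monoid" where
  "vertex_aut_group V U = BijGroup U \<lparr>carrier := vertex_automorphisms V U\<rparr>"

definition fixed_points :: "'v set \<Rightarrow> ('v \<Rightarrow> 'v) set \<Rightarrow> 'v set" where
  "fixed_points U G = {v \<in> U. \<forall>g\<in>G. g v = v}"


section \<open>Tensor products of vertex subalgebras\<close>

text \<open>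
  Elements of \<open>\<Prod>\<^sub>j L j\<close> are the functions in \<open>Pi\<^sub>E I L\<close>.
\<close>

definition multilinear_on ::
  "(complex \<Rightarrow> 'v \<Rightarrow> 'v) \<Rightarrow> (complex \<Rightarrow> 'w \<Rightarrow> 'w) \<Rightarrow> 'i set \<Rightarrow> ('i \<Rightarrow> 'v::ab_group_add set) \<Rightarrow>
   (('i \<Rightarrow> 'v) \<Rightarrow> 'w::ab_group_add) \<Rightarrow> bool" where
  "multilinear_on s s' I L \<phi> \<longleftrightarrow>
     (\<forall>a \<in> Pi\<^sub>E I L. \<forall>j\<in>I. \<forall>x\<in>L j. \<forall>y\<in>L j. \<forall>c.
        \<phi> (a(j := x + y)) = \<phi> (a(j := x)) + \<phi> (a(j := y)) \<and>
        \<phi> (a(j := s c x)) = s' c (\<phi> (a(j := x))))"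

text \<open>
  \<open>(U, t)\<close> is a tensor product of the vector spaces \<open>L j\<close>: the map \<open>t\<close> is multilinear, its values
  span \<open>U\<close>, and every multilinear form factors through it.  Testing with scalar-valued maps is
  enough over a field: it says that the transpose of the canonical linear map from the algebraic
  tensor product onto \<open>U\<close> is surjective, i.e. that this map is injective.  The form \<open>f\<close> on \<open>U\<close> is
  given through an extension to all of \<open>'v\<close>, which always exists.
\<close>

definition is_tensor_product ::
  "(complex \<Rightarrow> 'v \<Rightarrow> 'v) \<Rightarrow> 'i set \<Rightarrow> ('i \<Rightarrow> 'v::ab_group_add set) \<Rightarrow> 'v set \<Rightarrow> (('i \<Rightarrow> 'v) \<Rightarrow> 'v) \<Rightarrow> bool"
  where
  "is_tensor_product s I L U t \<longleftrightarrow>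
     multilinear_on s s I L t \<and>
     module.span s (t ` Pi\<^sub>E I L) = U \<and>
     (\<forall>\<phi>. multilinear_on s (*) I L \<phi> \<longrightarrow>
        (\<exists>f. Vector_Spaces.linear s (*) f \<and> (\<forall>a \<in> Pi\<^sub>E I L. f (t a) = \<phi> a)))"

text \<open>
  \<open>U\<close> is the tensor product vertex algebra of its (purely even) subalgebras \<open>L j\<close>: it is the tensor
  product of the vector spaces, \<open>Y(\<Otimes>a\<^sub>j, z) = \<Otimes>Y(a\<^sub>j, z)\<close>, the vacuum is \<open>\<Otimes>vac\<close>, and the canonical
  embedding of the factor \<open>L j\<close> is the inclusion.  Comparing coefficients of \<open>z\<^bsup>-q-1\<^esup>\<close> gives
  \<open>(\<Otimes>a\<^sub>j)\<^sub>(\<^sub>q\<^sub>) (\<Otimes>b\<^sub>j) = \<Sum> \<Otimes>((a\<^sub>j)\<^sub>(\<^sub>p\<^sub>j\<^sub>) b\<^sub>j)\<close>, the sum being over all \<open>p\<close> with \<open>\<Sum>\<^sub>j (p\<^sub>j + 1) = q + 1\<close>; only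
  finitely many of its terms are nonzero.
\<close>

definition is_internal_tensor_product ::
  "'v::ab_group_add vertex_data \<Rightarrow> 'i set \<Rightarrow> ('i \<Rightarrow> 'v set) \<Rightarrow> 'v set \<Rightarrow> bool" where
  "is_internal_tensor_product V I L U \<longleftrightarrow>
     (\<forall>j\<in>I. vertex_subalgebra V (L j) \<and> L j \<subseteq> even_part V) \<and>
     vertex_subalgebra V U \<and>
     (\<exists>t. is_tensor_product (smul V) I L U t \<and>
        t (\<lambda>j\<in>I. vac V) = vac V \<and>
        (\<forall>j\<in>I. \<forall>x\<in>L j. t (\<lambda>i\<in>I. if i = j then x else vac V) = x) \<and>
        (\<forall>a \<in> Pi\<^sub>E I L. \<forall>b \<in> Pi\<^sub>E I L. \<forall>q.
           mode V (t a) q (t b) =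
           Sum_any (\<lambda>p :: 'i \<Rightarrow> int.
             if p \<in> extensional I \<and> (\<Sum>j\<in>I. p j + 1) = q + 1
             then t (\<lambda>j\<in>I. mode V (a j) (p j) (b j)) else 0)))"


section \<open>Free fermions\<close>

text \<open>
  Half-integral modes are indexed by integers: \<open>\<psi> k i p\<close> is the Clifford generator
  \<open>\<psi>\<^sub>k\<^sub>i(p + 1/2)\<close>, so that \<open>\<psi>\<^sub>k\<^sub>i(z) = \<Sum>\<^sub>p \<psi> k i p z\<^bsup>-p-1\<^esup>\<close> and \<open>r + s = 0\<close> for \<open>r = p + 1/2\<close>, \<open>s = q + 1/2\<close>
  becomes \<open>p + q = -1\<close>.  In particular \<open>\<psi> k i (-1)\<close> is \<open>\<psi>\<^sub>k\<^sub>i(-1/2)\<close>.  Indices range over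
  \<open>1 \<le> k \<le> K\<close> and \<open>1 \<le> i \<le> n\<close>; the values of \<open>\<psi>\<close> at other indices are irrelevant.

  The locale describes the irreducible Clifford module generated by the vacuum together with the
  vertex superalgebra structure on it determined by the fields \<open>\<psi>\<^sub>k\<^sub>i(z)\<close>.
\<close>

locale free_fermions = vertex_superalgebra V
  for V :: "'v::ab_group_add vertex_data" +
  fixes \<psi> :: "nat \<Rightarrow> nat \<Rightarrow> int \<Rightarrow> 'v \<Rightarrow> 'v" and K n :: nat
  assumes psi_linear:
      "\<lbrakk>k \<in> {1..K}; i \<in> {1..n}\<rbrakk> \<Longrightarrow> Vector_Spaces.linear (smul V) (smul V) (\<psi> k i p)"
    and clifford:
      "\<lbrakk>k \<in> {1..K}; i \<in> {1..n}; l \<in> {1..K}; j \<in> {1..n}\<rbrakk> \<Longrightarrow>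
       \<psi> k i p (\<psi> l j q v) + \<psi> l j q (\<psi> k i p v) = (if k = l \<and> i = j \<and> p + q = -1 then v else 0)"
    and psi_vac: "\<lbrakk>k \<in> {1..K}; i \<in> {1..n}; p \<ge> 0\<rbrakk> \<Longrightarrow> \<psi> k i p (vac V) = 0"
    and vac_nonzero: "vac V \<noteq> 0"
    and irreducible:
      "\<lbrakk>module.subspace (smul V) W;
        \<And>k i p v. \<lbrakk>k \<in> {1..K}; i \<in> {1..n}; v \<in> W\<rbrakk> \<Longrightarrow> \<psi> k i p v \<in> W\<rbrakk> \<Longrightarrow> W = {0} \<or> W = UNIV"
    and psi_odd:
      "\<lbrakk>k \<in> {1..K}; i \<in> {1..n}\<rbrakk> \<Longrightarrow> \<psi> k i (-1) (vac V) \<in> odd_part V"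
    and psi_field:
      "\<lbrakk>k \<in> {1..K}; i \<in> {1..n}\<rbrakk> \<Longrightarrow> mode V (\<psi> k i (-1) (vac V)) p = \<psi> k i p"

definition psi_quadratic ::
  "'v vertex_data \<Rightarrow> (nat \<Rightarrow> nat \<Rightarrow> int \<Rightarrow> 'v \<Rightarrow> 'v) \<Rightarrow> nat \<Rightarrow> nat \<Rightarrow> nat \<Rightarrow> nat \<Rightarrow> 'v" where
  "psi_quadratic V \<psi> k j r s = \<psi> k j (-1) (\<psi> r s (-1) (vac V))"

text \<open>
  For \<open>K = 2m\<close>, with \<open>so\<^sub>r\<close> standing for \<open>so\<^sub>r(\<complex>)\<close>: the level 1 algebra of \<open>so\<^sub>2\<^sub>m\<^sub>n\<close> is realized as the even
  part, its \<open>j\<close>-th level 1 \<open>so\<^sub>2\<^sub>m\<close> subalgebra as \<open>so_level_one_factor V \<psi> (2*m) j\<close>, and the diagonal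
  level \<open>n\<close> subalgebra of \<open>so\<^sub>2\<^sub>m\<close> as \<open>so_diagonal V \<psi> (2*m) n\<close>.
\<close>

definition so_level_one :: "'v vertex_data \<Rightarrow> 'v set" where
  "so_level_one V = even_part V"

definition so_level_one_factor ::
  "'v::ab_group_add vertex_data \<Rightarrow> (nat \<Rightarrow> nat \<Rightarrow> int \<Rightarrow> 'v \<Rightarrow> 'v) \<Rightarrow> nat \<Rightarrow> nat \<Rightarrow> 'v set" where
  "so_level_one_factor V \<psi> K j =
     generated_subalgebra V {psi_quadratic V \<psi> k j l j | k l. k \<in> {1..K} \<and> l \<in> {1..K}}"

definition so_diagonal ::
  "'v::ab_group_add vertex_data \<Rightarrow> (nat \<Rightarrow> nat \<Rightarrow> int \<Rightarrow> 'v \<Rightarrow> 'v) \<Rightarrow> nat \<Rightarrow> nat \<Rightarrow> 'v set" where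
  "so_diagonal V \<psi> K n =
     generated_subalgebra V
       {\<Sum>j=1..n. psi_quadratic V \<psi> k j l j | k l. k \<in> {1..K} \<and> l \<in> {1..K}}"

definition sigma ::
  "'v::ab_group_add vertex_data \<Rightarrow> (nat \<Rightarrow> nat \<Rightarrow> int \<Rightarrow> 'v \<Rightarrow> 'v) \<Rightarrow> nat \<Rightarrow> nat \<Rightarrow> nat \<Rightarrow> 'v \<Rightarrow> 'v" where
  "sigma V \<psi> K n i =
     (THE f. f \<in> vertex_automorphisms V (so_level_one V) \<and>
        (\<forall>k\<in>{1..K}. \<forall>r\<in>{1..K}. \<forall>j\<in>{1..n}. \<forall>s\<in>{1..n}.
           f (psi_quadratic V \<psi> k j r s) =
           smul V ((-1) ^ (of_bool (i = j) + of_bool (i = s))) (psi_quadratic V \<psi> k j r s)))"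

definition sigma_group ::
  "'v::ab_group_add vertex_data \<Rightarrow> (nat \<Rightarrow> nat \<Rightarrow> int \<Rightarrow> 'v \<Rightarrow> 'v) \<Rightarrow> nat \<Rightarrow> nat \<Rightarrow> ('v \<Rightarrow> 'v) set" where
  "sigma_group V \<psi> K n =
     generate (vertex_aut_group V (so_level_one V)) (sigma V \<psi> K n ` {1..n})"

end

theory Submission
  imports Defs
begin

text \<open>
  Write \<open>\<psi>\<^sub>A\<close> for the free fermion field with label \<open>A = (k, i)\<close>, and call the labels with second entry
  \<open>j\<close> the \<open>j\<close>-th column.  The whole space is spanned by words: products of Clifford generators applied to
  the vacuum.  Everything follows from three descriptions in terms of words.

  The vertex algebra generated by the quadratic vectors \<open>\<psi>\<^sub>A(-1/2) \<psi>\<^sub>B(-1/2) 1\<close> with \<open>A\<close>, \<open>B\<close> in a set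
  \<open>S\<close> of at least three labels is the span of the words of even length in the generators with labels in
  \<open>S\<close> (\<open>generated_quadratics\<close>).  With three labels available, Clifford contractions produce every
  \<open>\<psi>\<^sub>A(r) \<psi>\<^sub>B(-1/2) 1\<close> from the quadratic vectors, and weak associativity then expresses
  \<open>\<psi>\<^sub>A(r) \<psi>\<^sub>B(s) v\<close> through modes of these vectors (\<open>product_of_modes_in_subalgebra\<close>).  For \<open>S\<close> the set of
  all labels this gives the even part, so \<open>\<sigma>\<^sub>i\<close> is determined by its values on quadratic vectors; for \<open>S\<close>
  the \<open>j\<close>-th column it describes the \<open>j\<close>-th factor.

  The automorphism \<open>\<sigma>\<^sub>i\<close> multiplies a word by \<open>-1\<close> to the number of its generators in column \<open>i\<close>.  It
  exists because the words with an odd number of such generators and those with an even number span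
  complementary subspaces: the intersection of the two spans is stable under all Clifford
  generators, and it does not contain the vacuum, so it is \<open>0\<close> by irreducibility
  (\<open>word_span_disjoint\<close>).  Averaging over the \<open>\<sigma>\<^sub>i\<close> shows that the fixed points are the span of the words
  in which every column occurs an even number of times.  As generators of different columns
  anticommute, such a word is, up to sign, a product of pairs taken from a single column, and hence
  lies in the algebra generated by the factors (\<open>even_word_mem\<close>, \<open>fixed_points_eq_generated\<close>).

  The factors commute with one another, so \<open>a\<^sub>1 \<otimes> \<dots> \<otimes> a\<^sub>n\<close> can be realized as the iterated product
  \<open>(a\<^sub>1)\<^sub>(\<^sub>-\<^sub>1\<^sub>) \<dots> (a\<^sub>n)\<^sub>(\<^sub>-\<^sub>1\<^sub>) 1\<close>, and the formula for its modes follows by induction from the case of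
  two commuting algebras (\<open>commuting_product_mode\<close>, \<open>tensor_list_mode\<close>).  For injectivity one needs that the
  products of basis vectors of the factors are linearly independent.  On finitely many vectors of
  a factor any linear form \<open>f\<close> is realized as \<open>v \<mapsto> f(v) 1\<close> by an operator built from the Clifford
  generators of that column (\<open>density\<close>).  Such an operator commutes with the other factors, so
  applying one for each column to a linear relation isolates a single coefficient
  (\<open>separating_operator\<close>, \<open>tensor_basis_independent\<close>).
\<close>

section \<open>Binomial coefficients and mode indices\<close>

lemma gchoose_minus_one: "(-1) ^ i * ((-1 :: complex) gchoose i) = 1"
  by (simp add: gbinomial_pochhammer pochhammer_fact[symmetric] flip: power_mult_distrib mult.assoc)

lemma gchoose_minus_two: "(-1) ^ i * ((-2 :: complex) gchoose i) = of_nat (Suc i)"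
proof -
  have "pochhammer (2 :: complex) i = fact (Suc i)"
    using pochhammer_rec[of "1 :: complex" i] by (simp add: pochhammer_fact del: fact_Suc)
  then show ?thesis
    by (simp add: gbinomial_pochhammer flip: power_mult_distrib mult.assoc)
qed

text \<open>
  An upper bound on all summands of a fixed sum also bounds each of them from below.  This makes the
  sum in the mode formula of a tensor product finite, truncation supplying the upper bound.
\<close>

lemma finite_mode_indices:
  fixes N q :: int
  assumes "finite S"
  shows "finite {p \<in> extensional S. (\<Sum>j\<in>S. p j + 1) = q \<and> (\<forall>j\<in>S. p j < N)}"
proof (rule finite_subset)
  let ?L = "q - 1 - int (card S) * \<bar>N\<bar>"
  show "{p \<in> extensional S. (\<Sum>j\<in>S. p j + 1) = q \<and> (\<forall>j\<in>S. p j < N)} \<subseteq> Pi\<^sub>E S (\<lambda>_. {?L..N})"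
  proof safe
    fix p j assume p: "p \<in> extensional S" "\<forall>j\<in>S. p j < N" and j: "j \<in> S" and q: "q = (\<Sum>j\<in>S. p j + 1)"
    have "(\<Sum>i\<in>S - {j}. p i + 1) \<le> int (card (S - {j})) * \<bar>N\<bar>"
      using p by (intro sum_bounded_above) force
    also have "\<dots> \<le> int (card S) * \<bar>N\<bar>"
      using card_mono[OF assms, of "S - {j}"] by (intro mult_right_mono) auto
    also have "(\<Sum>i\<in>S - {j}. p i + 1) = q - (p j + 1)"
      using assms j q by (simp add: sum_diff1)
    finally have "p j \<ge> ?L" by simp
    then show "p j \<in> {(\<Sum>j\<in>S. p j + 1) - 1 - int (card S) * \<bar>N\<bar>..N}" using p j q by auto
  qed (auto simp: extensional_def)
  show "finite (Pi\<^sub>E S (\<lambda>_. {?L..N}))" using assms by (intro finite_PiE) auto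
qed

section \<open>Products of modes in a vertex superalgebra\<close>

context vertex_superalgebra
begin

abbreviation lin :: "('v \<Rightarrow> 'v) \<Rightarrow> bool" where
  "lin \<equiv> Vector_Spaces.linear (smul V) (smul V)"

lemma linI:
  assumes "\<And>x y. X (x + y) = X x + X y" "\<And>c x. X (smul V c x) = smul V c (X x)"
  shows "lin X"
  unfolding linear_iff_module_hom
  by (simp add: module_hom_def module_hom_axioms_def assms module_axioms)

lemma lin_add: "lin X \<Longrightarrow> X (x + y) = X x + X y"
  and lin_diff: "lin X \<Longrightarrow> X (x - y) = X x - X y"
  and lin_neg: "lin X \<Longrightarrow> X (- x) = - X x"
  and lin_zero: "lin X \<Longrightarrow> X 0 = 0"
  and lin_scale: "lin X \<Longrightarrow> X (smul V c x) = smul V c (X x)"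
  and lin_sum: "lin X \<Longrightarrow> X (sum g I) = (\<Sum>i\<in>I. X (g i))"
  unfolding linear_iff_module_hom
  by (fact module_hom.add module_hom.diff module_hom.neg module_hom.zero module_hom.scale module_hom.sum)+

lemmas mode_left_simps =
  lin_add[OF mode_linear_left] lin_diff[OF mode_linear_left] lin_neg[OF mode_linear_left]
  lin_zero[OF mode_linear_left] lin_scale[OF mode_linear_left]

lemmas mode_right_simps =
  lin_add[OF mode_linear_right] lin_diff[OF mode_linear_right] lin_neg[OF mode_linear_right]
  lin_zero[OF mode_linear_right] lin_scale[OF mode_linear_right]

lemma lin_comp: "lin X \<Longrightarrow> lin Y \<Longrightarrow> lin (\<lambda>v. X (Y v))"
  by (rule linI) (simp_all add: lin_add lin_scale)

lemma lin_Sum_any: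
  assumes "lin X" "finite {i. g i \<noteq> 0}"
  shows "X (Sum_any g) = Sum_any (\<lambda>i. X (g i))"
proof -
  have "Sum_any (\<lambda>i. X (g i)) = (\<Sum>i\<in>{i. g i \<noteq> 0}. X (g i))"
    using assms by (intro Sum_any.expand_superset) (auto simp: lin_zero)
  then show ?thesis
    by (simp add: Sum_any.expand_set lin_sum[OF assms(1)])
qed

lemma lin_span_subset:
  assumes "lin X" "\<And>x. x \<in> B \<Longrightarrow> X x \<in> U" "subspace U" "v \<in> span B"
  shows "X v \<in> U"
  using assms(4)
proof (rule span_induct)
  show "subspace {v. X v \<in> U}"
    using assms(1,3) by (auto simp: subspace_def lin_add lin_scale lin_zero)
qed (use assms(2) in auto)

lemma lin_eq_on_span:
  assumes "lin X" "lin Y" "\<And>x. x \<in> B \<Longrightarrow> X x = Y x" "v \<in> span B"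
  shows "X v = Y v"
  using assms(4)
proof (rule span_induct)
  show "subspace {v. X v = Y v}"
    using assms(1,2) by (auto simp: subspace_def lin_add lin_scale lin_zero)
qed (use assms(3) in auto)

lemma Sum_any_in_subspace:
  assumes "subspace U" "\<And>i. g i \<in> U"
  shows "Sum_any g \<in> U"
  unfolding Sum_any.expand_set using assms by (intro subspace_sum) auto

lemma Sum_any_single:
  fixes g :: "'a \<Rightarrow> 'v"
  assumes "\<And>i. i \<noteq> k \<Longrightarrow> g i = 0"
  shows "Sum_any g = g k"
proof -
  have "Sum_any g = sum g {k}"
    using assms by (intro Sum_any.expand_superset) auto
  then show ?thesis by simp
qed

text \<open>
  The sign in the Borcherds identity depends on parities, so the identity speaks of these vectors.
\<close>

definition homogeneous :: "'v set" where
  "homogeneous = even_part V \<union> odd_part V"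

text \<open>
  The Borcherds identity at \<open>p = 0\<close>, where only the term \<open>i = 0\<close> on its left-hand side survives.  It
  writes the modes of \<open>a\<^sub>(\<^sub>r\<^sub>) b\<close> through those of \<open>a\<close> and \<open>b\<close>, so that properties of modes pass from the
  generating fields to all words.
\<close>

lemma iterate_formula:
  assumes "a \<in> homogeneous" "b \<in> homogeneous"
  shows "mode V (mode V a r b) q c =
    Sum_any (\<lambda>i::nat. smul V ((-1) ^ i * (of_int r gchoose i))
      (mode V a (r - int i) (mode V b (q + int i) c)
       - smul V (parity_sign V a b * (-1) powi r)
           (mode V b (q + r - int i) (mode V a (int i) c))))"
proof -
  have "Sum_any (\<lambda>i::nat. smul V (of_int 0 gchoose i)
           (mode V (mode V a (r + int i) b) (0 + q - int i) c)) = mode V (mode V a r b) q c"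
    by (subst Sum_any_single[where k = 0]) (auto simp: gbinomial_0_left)
  then show ?thesis
    using borcherds[of a b 0 r q c] assms by (simp add: homogeneous_def)
qed

lemma iterate_finite:
  "finite {i::nat. smul V ((-1) ^ i * (of_int r gchoose i))
      (mode V a (r - int i) (mode V b (q + int i) c)
       - smul V s (mode V b (q + r - int i) (mode V a (int i) c))) \<noteq> 0}"
proof -
  obtain M where M: "\<forall>p\<ge>M. mode V b p c = 0" using truncation by blast
  obtain N where N: "\<forall>p\<ge>N. mode V a p c = 0" using truncation by blast
  have "{i::nat. smul V ((-1) ^ i * (of_int r gchoose i))
      (mode V a (r - int i) (mode V b (q + int i) c)
       - smul V s (mode V b (q + r - int i) (mode V a (int i) c))) \<noteq> 0} \<subseteq> {..nat (M - q) + nat N}"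
  proof
    fix i
    assume *: "i \<in> {i::nat. smul V ((-1) ^ i * (of_int r gchoose i))
      (mode V a (r - int i) (mode V b (q + int i) c)
       - smul V s (mode V b (q + r - int i) (mode V a (int i) c))) \<noteq> 0}"
    show "i \<in> {..nat (M - q) + nat N}"
    proof (rule ccontr)
      assume "\<not> ?thesis"
      then have "q + int i \<ge> M" "int i \<ge> N" by auto
      then have "mode V b (q + int i) c = 0" "mode V a (int i) c = 0"
        using M N by auto
      with * show False by (simp add: mode_right_simps)
    qed
  qed
  then show ?thesis by (rule finite_subset) simp
qed

lemma iterate_in_subspace:
  assumes "a \<in> homogeneous" "b \<in> homogeneous" "subspace U"
    and "\<And>p q. mode V a p (mode V b q c) \<in> U" "\<And>p q. mode V b p (mode V a q c) \<in> U"
  shows "mode V (mode V a r b) q c \<in> U"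
  unfolding iterate_formula[OF assms(1,2)]
  using assms by (intro Sum_any_in_subspace subspace_scale subspace_diff) auto

text \<open>
  Each term of \<open>iterate_formula\<close> contains one mode of \<open>a\<close> and one of \<open>b\<close>, so the two factors multiply.
  The scalars are \<open>-1\<close> for a fermion passing another fermion and for a sign automorphism acting on a
  negated fermion.
\<close>

lemma iterate_commute:
  assumes "a \<in> homogeneous" "b \<in> homogeneous" "lin X"
    and a: "\<And>p c. X (mode V a p c) = smul V \<epsilon> (mode V a p (X c))"
    and b: "\<And>p c. X (mode V b p c) = smul V \<delta> (mode V b p (X c))"
  shows "X (mode V (mode V a r b) q c) = smul V (\<epsilon> * \<delta>) (mode V (mode V a r b) q (X c))"
proof -
  let ?g = "\<lambda>c (i::nat). smul V ((-1) ^ i * (of_int r gchoose i))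
      (mode V a (r - int i) (mode V b (q + int i) c)
       - smul V (parity_sign V a b * (-1) powi r)
           (mode V b (q + r - int i) (mode V a (int i) c)))"
  have "X (Sum_any (?g c)) = Sum_any (\<lambda>i. X (?g c i))"
    by (rule lin_Sum_any[OF assms(3) iterate_finite])
  also have "\<dots> = Sum_any (\<lambda>i. smul V (\<epsilon> * \<delta>) (?g (X c) i))"
    using assms(3)
    by (simp add: lin_scale lin_diff a b mode_right_simps scale_right_diff_distrib mult_ac)
  also have "\<dots> = smul V (\<epsilon> * \<delta>) (Sum_any (?g (X c)))"
    by (rule lin_Sum_any[symmetric, OF _ iterate_finite])
       (auto intro!: linI simp: scale_right_distrib mult_ac)
  finally show ?thesis
    by (simp add: iterate_formula[OF assms(1,2)])
qed

text \<open>
  Weak associativity.  If \<open>N\<close> is large enough for \<open>a\<^sub>(\<^sub>p\<^sub>) c\<close> to vanish for \<open>p \<ge> N\<close>, the Borcherds identity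
  with parameters \<open>(N, q, s - N)\<close> has no terms \<open>b a\<close>.  Its left-hand side lies in \<open>U\<close>, and the right-hand side is
  \<open>a\<^sub>(\<^sub>s\<^sub>) b\<^sub>(\<^sub>q\<^sub>) c\<close> plus terms \<open>a\<^sub>(\<^sub>s\<^sub>-\<^sub>i\<^sub>) b\<^sub>(\<^sub>q\<^sub>+\<^sub>i\<^sub>) c\<close> with \<open>i > 0\<close>.  Descending induction on \<open>q\<close> starts where
  \<open>b\<^sub>(\<^sub>q\<^sub>) c = 0\<close>.
\<close>

lemma product_of_modes_in_subalgebra:
  assumes U: "vertex_subalgebra V U" and ab: "a \<in> homogeneous" "b \<in> homogeneous"
    and prod: "\<And>s. mode V a s b \<in> U" and c: "c \<in> U"
  shows "mode V a s (mode V b q c) \<in> U"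
proof -
  have sub: "subspace U" and closed: "\<And>x y p. x \<in> U \<Longrightarrow> y \<in> U \<Longrightarrow> mode V x p y \<in> U"
    using U by (auto simp: vertex_subalgebra_def)
  obtain M where M: "\<forall>p\<ge>M. mode V b p c = 0" using truncation by blast
  obtain N where N: "\<forall>p\<ge>N. mode V a p c = 0" using truncation by blast
  show ?thesis
  proof (induction "nat (M - q)" arbitrary: q s rule: less_induct)
    case less
    show ?case
    proof (cases "q \<ge> M")
      case True
      then show ?thesis using M sub by (simp add: mode_right_simps subspace_0)
    next
      case False
      \<comment> \<open>The right-hand side of the Borcherds identity once \<open>a\<close> annihilates \<open>c\<close>; its term \<open>i = 0\<close> is the vector in question.\<close>
      define g where "g i = smul V ((-1) ^ i * (of_int (s - N) gchoose i))
        (mode V a (s - int i) (mode V b (q + int i) c))" for i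
      have fin: "finite {i. g i \<noteq> 0}"
      proof (rule finite_subset)
        show "{i. g i \<noteq> 0} \<subseteq> {..nat (M - q)}"
        proof
          fix i assume "i \<in> {i. g i \<noteq> 0}"
          then have "\<not> q + int i \<ge> M"
            using M by (auto simp: g_def mode_right_simps)
          then show "i \<in> {..nat (M - q)}" by auto
        qed
      qed simp
      have "Sum_any (\<lambda>i::nat. smul V (of_int N gchoose i)
           (mode V (mode V a (s - N + int i) b) (N + q - int i) c)) = Sum_any g"
        using borcherds[of a b N "s - N" q c] ab N
        by (simp add: homogeneous_def g_def mode_right_simps)
      moreover have "Sum_any (\<lambda>i::nat. smul V (of_int N gchoose i)
           (mode V (mode V a (s - N + int i) b) (N + q - int i) c)) \<in> U"
        using prod c closed sub by (intro Sum_any_in_subspace subspace_scale) auto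
      ultimately have S: "Sum_any g \<in> U" by simp
      define h where "h i = (if i = 0 then 0 else g i)" for i
      have "h i \<in> U" for i
        using less[of "q + int i" "s - int i"] False sub
        by (auto simp: h_def g_def intro!: subspace_scale subspace_0)
      then have H: "Sum_any h \<in> U" by (rule Sum_any_in_subspace[OF sub])
      have "Sum_any g = Sum_any (\<lambda>i. (if i = 0 then g 0 else 0) + h i)"
        by (intro arg_cong[of _ _ Sum_any]) (auto simp: h_def)
      also have "\<dots> = Sum_any (\<lambda>i::nat. if i = 0 then g 0 else 0) + Sum_any h"
        by (rule Sum_any.distrib) (auto intro: finite_subset[OF _ fin] simp: h_def)
      also have "Sum_any (\<lambda>i::nat. if i = 0 then g 0 else 0) = g 0"
        by (subst Sum_any_single[where k = 0]) auto
      finally have "g 0 = Sum_any g - Sum_any h" by simp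
      also have "\<dots> \<in> U" using S H sub by (rule_tac subspace_diff) auto
      finally show ?thesis by (simp add: g_def)
    qed
  qed
qed

lemma vertex_subalgebraD:
  assumes "vertex_subalgebra V U"
  shows "subspace U" "vac V \<in> U" "a \<in> U \<Longrightarrow> b \<in> U \<Longrightarrow> mode V a p b \<in> U"
  using assms by (auto simp: vertex_subalgebra_def)

lemma generated_subalgebra_vertex_subalgebra: "vertex_subalgebra V (generated_subalgebra V S)"
  unfolding generated_subalgebra_def vertex_subalgebra_def
  by (auto intro!: subspace_Inter)

lemma generated_subalgebra_superset: "S \<subseteq> generated_subalgebra V S"
  unfolding generated_subalgebra_def by auto

lemma generated_subalgebra_least:
  "vertex_subalgebra V U \<Longrightarrow> S \<subseteq> U \<Longrightarrow> generated_subalgebra V S \<subseteq> U"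
  unfolding generated_subalgebra_def by auto

lemma even_part_vertex_subalgebra: "vertex_subalgebra V (even_part V)"
  using even_subspace vac_even mode_even_even by (simp add: vertex_subalgebra_def)

lemma fixed_points_vertex_subalgebra:
  assumes "vertex_subalgebra V U" "G \<subseteq> vertex_automorphisms V U"
  shows "vertex_subalgebra V (fixed_points U G)"
proof -
  note U = vertex_subalgebraD[OF assms(1)]
  have g: "g (vac V) = vac V" "\<And>a b. a \<in> U \<Longrightarrow> b \<in> U \<Longrightarrow> g (a + b) = g a + g b"
    "\<And>a c. a \<in> U \<Longrightarrow> g (smul V c a) = smul V c (g a)"
    "\<And>a b p. a \<in> U \<Longrightarrow> b \<in> U \<Longrightarrow> g (mode V a p b) = mode V (g a) p (g b)" if "g \<in> G" for g
    using assms(2) that by (auto simp: vertex_automorphisms_def)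
  have "g 0 = 0" if "g \<in> G" for g
    using g(3)[OF that U(2), of 0] by simp
  then show ?thesis
    using U
    by (auto simp: vertex_subalgebra_def fixed_points_def subspace_def g(1)) (metis g(2-4))+
qed

abbreviation form :: "('v \<Rightarrow> complex) \<Rightarrow> bool" where
  "form \<equiv> Vector_Spaces.linear (smul V) (*)"

text \<open>
  Linear forms are linear maps into the field as a vector space over itself, so that the general
  results on extending linear maps apply to them.
\<close>

lemma vector_space_pair_complex: "vector_space_pair (smul V) ((*) :: complex \<Rightarrow> complex \<Rightarrow> complex)"
  by unfold_locales (simp_all add: algebra_simps)

lemma form_add: "form f \<Longrightarrow> f (x + y) = f x + f y"
  and form_scale: "form f \<Longrightarrow> f (smul V c x) = c * f x"
  unfolding linear_iff_module_hom by (fact module_hom.add module_hom.scale)+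

lemma form_comp: "form f \<Longrightarrow> lin X \<Longrightarrow> form (\<lambda>v. f (X v))"
  using vector_space_pair_complex
  by (simp add: linear_iff_module_hom module_hom_def module_hom_axioms_def)

lemma form_extend: "independent B \<Longrightarrow> \<exists>f. form f \<and> (\<forall>x\<in>B. f x = g x)"
  by (rule vector_space_pair.linear_independent_extend[OF vector_space_pair_complex])

text \<open>
  The two halves of \<open>iterate_formula\<close> for \<open>r = -1\<close> run over the negative and the nonnegative modes of
  the first field; for commuting fields they join to one sum over all integers.
\<close>

lemma Sum_any_int:
  fixes g :: "int \<Rightarrow> 'v"
  assumes "finite {s. g s \<noteq> 0}"
  shows "Sum_any (\<lambda>i::nat. g (-1 - int i) + g (int i)) = Sum_any g"
proof -
  obtain M where M: "\<And>s. g s \<noteq> 0 \<Longrightarrow> \<bar>s\<bar> < int M"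
  proof -
    have "finite ((\<lambda>s. nat \<bar>s\<bar>) ` {s. g s \<noteq> 0})" using assms by simp
    then obtain M where "\<forall>x\<in>(\<lambda>s. nat \<bar>s\<bar>) ` {s. g s \<noteq> 0}. x < M"
      using finite_nat_set_iff_bounded by blast
    then show thesis using that[of M] by force
  qed
  have "Sum_any g = sum g ({-int M..-1} \<union> {0..<int M})"
    using M by (intro Sum_any.expand_superset) (force)+
  also have "\<dots> = sum g {-int M..-1} + sum g {0..<int M}"
    by (rule sum.union_disjoint) auto
  also have "sum g {0..<int M} = (\<Sum>i<M. g (int i))"
    by (rule sum.reindex_bij_witness[of _ int nat]) auto
  also have "sum g {-int M..-1} = (\<Sum>i<M. g (-1 - int i))"
    by (rule sum.reindex_bij_witness[of _ "\<lambda>i. -1 - int i" "\<lambda>s. nat (-1 - s)"]) auto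
  also have "(\<Sum>i<M. g (-1 - int i)) + (\<Sum>i<M. g (int i)) = (\<Sum>i<M. g (-1 - int i) + g (int i))"
    by (simp add: sum.distrib)
  also have "\<dots> = Sum_any (\<lambda>i::nat. g (-1 - int i) + g (int i))"
  proof (rule Sum_any.expand_superset[symmetric])
    show "{i. g (-1 - int i) + g (int i) \<noteq> 0} \<subseteq> {..<M}"
    proof
      fix i assume "i \<in> {i. g (-1 - int i) + g (int i) \<noteq> 0}"
      then have "g (-1 - int i) \<noteq> 0 \<or> g (int i) \<noteq> 0" by auto
      then show "i \<in> {..<M}" using M[of "-1 - int i"] M[of "int i"] by auto
    qed
  qed simp
  finally show ?thesis ..
qed

definition commuting :: "'v \<Rightarrow> 'v \<Rightarrow> bool" where
  "commuting a b \<longleftrightarrow> (\<forall>p q c. mode V a p (mode V b q c) = mode V b q (mode V a p c))"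

lemma commuting_vac: "commuting a (vac V)"
  by (auto simp: commuting_def vacuum lin_zero[OF mode_linear_right])

lemma commuting_mode:
  assumes "commuting a b" "commuting a c" "b \<in> even_part V" "c \<in> even_part V"
  shows "commuting a (mode V b p c)"
  using assms iterate_commute[of b c "mode V a _" 1 1 p] mode_linear_right
  by (simp add: commuting_def homogeneous_def)

text \<open>
  The mode formula for a tensor product of two algebras, with \<open>x\<close>, \<open>y\<close> in the first and \<open>v\<close>, \<open>w\<close> in the
  second.  Commutativity turns the normally ordered product \<open>x\<^sub>(\<^sub>-\<^sub>1\<^sub>) v\<close> into the plain convolution of the
  modes of \<open>x\<close> and \<open>v\<close>.  In each term \<open>v\<close> moves past \<open>y\<close>, and \<open>x\<^sub>(\<^sub>s\<^sub>) y\<^sub>(\<^sub>-\<^sub>1\<^sub>) u = (x\<^sub>(\<^sub>s\<^sub>) y)\<^sub>(\<^sub>-\<^sub>1\<^sub>) u\<close> because \<open>u\<close>, being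
  \<open>u\<^sub>(\<^sub>-\<^sub>1\<^sub>) vac\<close>, can be pulled out to the left on both sides.
\<close>

lemma commuting_product_mode:
  assumes even: "x \<in> even_part V" "y \<in> even_part V" "v \<in> even_part V" "w \<in> even_part V"
    and xv: "commuting x v" and xw: "commuting x w" and yv: "commuting y v" and yw: "commuting y w"
    and xyv: "\<And>s. commuting (mode V x s y) v" and xyw: "\<And>s. commuting (mode V x s y) w"
  shows "mode V (mode V x (-1) v) q (mode V y (-1) w)
    = Sum_any (\<lambda>s. mode V (mode V x s y) (-1) (mode V v (q - 1 - s) w))"
proof -
  let ?c = "mode V y (-1) w"
  define g where "g s = mode V x s (mode V v (q - 1 - s) ?c)" for s
  have swap: "g s = mode V v (q - 1 - s) (mode V x s ?c)" for s
    using xv by (simp add: g_def commuting_def)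
  obtain N where N: "\<forall>p\<ge>N. mode V x p ?c = 0" using truncation by blast
  obtain M where M: "\<forall>p\<ge>M. mode V v p ?c = 0" using truncation by blast
  have "finite {s. g s \<noteq> 0}"
  proof (rule finite_subset)
    show "{s. g s \<noteq> 0} \<subseteq> {q - 1 - M..N}"
    proof
      fix s assume s: "s \<in> {s. g s \<noteq> 0}"
      then have "mode V x s ?c \<noteq> 0" "mode V v (q - 1 - s) ?c \<noteq> 0"
        using lin_zero[OF mode_linear_right] swap[of s] by (auto simp: g_def)
      then have "\<not> s \<ge> N" "\<not> q - 1 - s \<ge> M" using N M by blast+
      then show "s \<in> {q - 1 - M..N}" by simp
    qed
  qed simp
  then have "Sum_any g = Sum_any (\<lambda>i::nat. g (-1 - int i) + g (int i))"
    by (rule Sum_any_int[symmetric])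
  also have "\<dots> = mode V (mode V x (-1) v) q ?c"
  \<comment> \<open>The zero vector is both even and odd, so its parity sign has to be kept apart.\<close>
  proof (cases "x = 0")
    case True
    then show ?thesis by (simp add: g_def mode_left_simps)
  next
    case False
    then have "x \<notin> odd_part V" using even even_Int_odd by blast
    then have "parity_sign V x v = 1" by (simp add: parity_sign_def)
    then show ?thesis
      using even by (subst iterate_formula)
        (auto simp: homogeneous_def trans[OF mult.commute gchoose_minus_one] g_def xv[unfolded commuting_def] algebra_simps)
  qed
  finally have "mode V (mode V x (-1) v) q ?c = Sum_any g" ..
  moreover have "g s = mode V (mode V x s y) (-1) (mode V v (q - 1 - s) w)" for s
  proof -
    let ?u = "mode V v (q - 1 - s) w"
    have u: "commuting x ?u" "commuting y ?u" "commuting (mode V x s y) ?u"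
      using assms by (auto intro: commuting_mode)
    have at_vac: "mode V z (-1) ?u = mode V ?u (-1) z" if "commuting z ?u" for z
      using that creation unfolding commuting_def by metis
    have "g s = mode V x s (mode V y (-1) ?u)"
      using yv by (simp add: g_def commuting_def)
    also have "\<dots> = mode V ?u (-1) (mode V x s y)"
      using at_vac[OF u(2)] u(1) by (simp add: commuting_def)
    also have "\<dots> = mode V (mode V x s y) (-1) ?u"
      by (rule at_vac[OF u(3), symmetric])
    finally show ?thesis .
  qed
  ultimately show ?thesis by simp
qed

end

section \<open>Words in the Clifford generators\<close>

context free_fermions
begin

definition labels :: "(nat \<times> nat) set" where "labels = {1..K} \<times> {1..n}"

abbreviation psi :: "nat \<times> nat \<Rightarrow> int \<Rightarrow> 'v \<Rightarrow> 'v" where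
  "psi A \<equiv> \<psi> (fst A) (snd A)"

definition generator :: "nat \<times> nat \<Rightarrow> 'v" where
  "generator A = psi A (-1) (vac V)"

lemma lin_psi: "A \<in> labels \<Longrightarrow> lin (psi A p)"
  by (rule psi_linear) (auto simp: labels_def)

lemmas psi_simps = lin_add[OF lin_psi] lin_diff[OF lin_psi] lin_neg[OF lin_psi]
  lin_zero[OF lin_psi] lin_scale[OF lin_psi]

lemma psi_anticommute:
  assumes "A \<in> labels" "B \<in> labels"
  shows "psi A p (psi B q v) = (if A = B \<and> p + q = -1 then v else 0) - psi B q (psi A p v)"
  using clifford[of "fst A" "snd A" "fst B" "snd B" p q v] assms
  by (auto simp: labels_def prod_eq_iff algebra_simps split: if_splits)

lemma psi_square:
  assumes "A \<in> labels" "2 * p \<noteq> -1"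
  shows "psi A p (psi A p v) = 0"
proof -
  have "psi A p (psi A p v) = - psi A p (psi A p v)"
    using psi_anticommute[OF assms(1,1), of p p v] assms by simp
  then have "psi A p (psi A p v) + psi A p (psi A p v) = 0"
    by (metis add.right_inverse)
  then have "smul V 2 (psi A p (psi A p v)) = 0"
    using scale_left_distrib[of 1 1 "psi A p (psi A p v)"] by simp
  then show ?thesis by simp
qed

lemma psi_annihilates_vac: "A \<in> labels \<Longrightarrow> p \<ge> 0 \<Longrightarrow> psi A p (vac V) = 0"
  by (rule psi_vac) (auto simp: labels_def)

lemma generator_odd: "A \<in> labels \<Longrightarrow> generator A \<in> odd_part V"
  unfolding generator_def by (rule psi_odd) (auto simp: labels_def)

lemma generator_homogeneous: "A \<in> labels \<Longrightarrow> generator A \<in> homogeneous"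
  using generator_odd by (auto simp: homogeneous_def)

lemma mode_generator: "A \<in> labels \<Longrightarrow> mode V (generator A) p = psi A p"
  unfolding generator_def by (rule psi_field) (auto simp: labels_def)

definition act :: "(nat \<times> nat) \<times> int \<Rightarrow> 'v \<Rightarrow> 'v" where
  "act x = psi (fst x) (snd x)"

definition word :: "((nat \<times> nat) \<times> int) list \<Rightarrow> 'v" where
  "word w = foldr act w (vac V)"

lemma word_simps [simp]: "word [] = vac V" "word (x # w) = act x (word w)"
  by (simp_all add: word_def)

definition letters :: "((nat \<times> nat) \<times> int) set" where
  "letters = labels \<times> UNIV"

definition creations :: "((nat \<times> nat) \<times> int) set" where
  "creations = labels \<times> {..<0}"

text \<open>
  Parity of the number of generators with label in \<open>Q\<close>.  With \<open>Q = UNIV\<close> this is the parity of the length,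
  with \<open>Q\<close> a column the sign under the corresponding automorphism, and \<open>Q = {}\<close> imposes no condition.
\<close>

definition odd_count :: "(nat \<times> nat) set \<Rightarrow> ((nat \<times> nat) \<times> int) list \<Rightarrow> bool" where
  "odd_count Q w = odd (length (filter (\<lambda>x. fst x \<in> Q) w))"

lemma odd_count_simps [simp]:
  "odd_count Q [] = False" "odd_count Q (x # w) = ((fst x \<in> Q) \<noteq> odd_count Q w)"
  by (auto simp: odd_count_def)

lemma odd_count_append: "odd_count Q (u @ w) = (odd_count Q u \<noteq> odd_count Q w)"
  by (auto simp: odd_count_def)

lemma odd_count_UNIV: "odd_count UNIV w = odd (length w)"
  by (simp add: odd_count_def)

lemma odd_count_empty [simp]: "odd_count {} w = False"
  by (simp add: odd_count_def)

text \<open>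
  A letter is a label together with a mode index, so \<open>X\<close> can restrict the labels (\<open>S \<times> UNIV\<close>), or select a
  finite set of creation operators, on which linear algebra becomes finite.
\<close>

definition word_span :: "((nat \<times> nat) \<times> int) set \<Rightarrow> (nat \<times> nat) set \<Rightarrow> bool \<Rightarrow> 'v set" where
  "word_span X Q e = span (word ` {w. set w \<subseteq> X \<and> odd_count Q w = e})"

lemma word_span_subspace: "subspace (word_span X Q e)"
  by (simp add: word_span_def)

lemma word_in_word_span: "set w \<subseteq> X \<Longrightarrow> odd_count Q w = e \<Longrightarrow> word w \<in> word_span X Q e"
  unfolding word_span_def by (rule span_base) auto

lemma vac_in_word_span: "vac V \<in> word_span X Q False"
  using word_in_word_span[of "[]" X Q False] by simp

lemma word_span_mono: "X \<subseteq> Y \<Longrightarrow> word_span X Q e \<subseteq> word_span Y Q e"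
  unfolding word_span_def by (rule span_mono) auto

lemma word_span_lin_induct:
  assumes "lin F" "subspace U" "v \<in> word_span X Q e"
    and "\<And>w. set w \<subseteq> X \<Longrightarrow> odd_count Q w = e \<Longrightarrow> F (word w) \<in> U"
  shows "F v \<in> U"
  using assms(3) unfolding word_span_def
  by (rule lin_span_subset[OF assms(1) _ assms(2), rotated]) (use assms(4) in auto)

lemma word_span_subset:
  assumes "subspace U" "\<And>w. set w \<subseteq> X \<Longrightarrow> odd_count Q w = e \<Longrightarrow> word w \<in> U"
  shows "word_span X Q e \<subseteq> U"
  unfolding word_span_def using assms by (intro span_minimal) auto

lemma lin_act: "x \<in> letters \<Longrightarrow> lin (act x)"
  by (cases x) (auto simp: act_def letters_def intro: lin_psi)

lemma creations_subset_letters: "creations \<subseteq> letters"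
  by (auto simp: creations_def letters_def)

lemma act_word_span:
  assumes "x \<in> X" "X \<subseteq> letters" "v \<in> word_span X Q e"
  shows "act x v \<in> word_span X Q ((fst x \<in> Q) \<noteq> e)"
proof (rule word_span_lin_induct[OF lin_act word_span_subspace assms(3)])
  fix w assume "set w \<subseteq> X" "odd_count Q w = e"
  then show "act x (word w) \<in> word_span X Q ((fst x \<in> Q) \<noteq> e)"
    using word_in_word_span[of "x # w" X Q] assms by auto
qed (use assms in auto)

text \<open>
  Moving an annihilation operator to the right through a word only deletes letters, one of its own label
  each time, until it reaches the vacuum.
\<close>

lemma annihilator_word_span:
  assumes "N \<subseteq> creations" "A \<in> labels" "p \<ge> 0" "v \<in> word_span N Q e"
  shows "psi A p v \<in> word_span N Q ((A \<in> Q) \<noteq> e)"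
proof (rule word_span_lin_induct[OF lin_psi word_span_subspace assms(4)])
  fix w assume "set w \<subseteq> N" "odd_count Q w = e"
  then show "psi A p (word w) \<in> word_span N Q ((A \<in> Q) \<noteq> e)"
  proof (induction w arbitrary: e)
    case Nil
    then show ?case using assms by (simp add: psi_annihilates_vac subspace_0 word_span_subspace)
  next
    case (Cons x w)
    obtain B q where x: "x = (B, q)" by (cases x)
    have B: "B \<in> labels" and xN: "x \<in> N" using Cons.prems x assms by (auto simp: creations_def)
    have "psi A p (word w) \<in> word_span N Q ((A \<in> Q) \<noteq> odd_count Q w)"
      using Cons by auto
    then have "act x (psi A p (word w)) \<in> word_span N Q ((fst x \<in> Q) \<noteq> ((A \<in> Q) \<noteq> odd_count Q w))"
      using assms creations_subset_letters by (intro act_word_span[OF xN]) auto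
    moreover have "((fst x \<in> Q) \<noteq> ((A \<in> Q) \<noteq> odd_count Q w)) = ((A \<in> Q) \<noteq> e)"
      using Cons.prems by auto
    ultimately have "act x (psi A p (word w)) \<in> word_span N Q ((A \<in> Q) \<noteq> e)" by simp
    moreover have "word w \<in> word_span N Q ((A \<in> Q) \<noteq> e)" if "A = B"
      using Cons.prems that by (intro word_in_word_span) (auto simp: x)
    moreover have "psi A p (word (x # w)) =
        (if A = B \<and> p + q = -1 then word w else 0) - act x (psi A p (word w))"
      using psi_anticommute[OF assms(2) B, of p q "word w"] by (simp add: act_def x)
    ultimately show ?case
      by (auto intro!: subspace_diff subspace_neg word_span_subspace subspace_0 simp del: word_simps)
  qed
qed (use assms in auto)

text \<open>
  Normal ordering, in the weak form that is needed: the annihilation operators of a word can be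
  eliminated without introducing new letters and without changing parities.
\<close>

lemma word_in_creation_word_span:
  assumes "set w \<subseteq> letters"
  shows "word w \<in> word_span (set w \<inter> creations) Q (odd_count Q w)"
  using assms
proof (induction w)
  case Nil
  then show ?case by (simp add: vac_in_word_span)
next
  case (Cons x w)
  have sub: "word_span (set w \<inter> creations) Q (odd_count Q w) \<subseteq> word_span (set (x # w) \<inter> creations) Q (odd_count Q w)"
    by (rule word_span_mono) auto
  then have w: "word w \<in> word_span (set (x # w) \<inter> creations) Q (odd_count Q w)"
    using Cons by auto
  show ?case
  proof (cases "x \<in> creations")
    case True
    then show ?thesis using act_word_span[OF _ _ w, of x] creations_subset_letters by auto
  next
    case False
    then show ?thesis using Cons.prems annihilator_word_span[OF _ _ _ w, of "fst x" "snd x"]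
      by (cases x) (auto simp: act_def creations_def letters_def)
  qed
qed

lemma word_span_finite_creation:
  assumes "X \<subseteq> letters" "v \<in> word_span X Q e"
  obtains N where "finite N" "N \<subseteq> X \<inter> creations" "v \<in> word_span N Q e"
proof -
  have "v \<in> {v. \<exists>N. finite N \<and> N \<subseteq> X \<inter> creations \<and> v \<in> word_span N Q e}" (is "v \<in> ?U")
  proof (rule subsetD[OF word_span_subset assms(2)])
    show "subspace ?U"
      unfolding subspace_def
    proof (safe)
      show "\<exists>N. finite N \<and> N \<subseteq> X \<inter> creations \<and> 0 \<in> word_span N Q e"
        by (rule exI[of _ "{}"]) (simp add: subspace_0 word_span_subspace)
    next
      fix x y N M
      assume "finite N" "N \<subseteq> X \<inter> creations" "x \<in> word_span N Q e" "finite M" "M \<subseteq> X \<inter> creations" "y \<in> word_span M Q e"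
      moreover from this have "x \<in> word_span (N \<union> M) Q e" "y \<in> word_span (N \<union> M) Q e"
        using word_span_mono[of N "N \<union> M" Q e] word_span_mono[of M "N \<union> M" Q e] by auto
      ultimately show "\<exists>N. finite N \<and> N \<subseteq> X \<inter> creations \<and> x + y \<in> word_span N Q e"
        by (intro exI[of _ "N \<union> M"]) (auto intro: subspace_add word_span_subspace)
    qed (auto intro: subspace_scale word_span_subspace)
    fix w assume "set w \<subseteq> X" "odd_count Q w = e"
    then show "word w \<in> ?U"
      using word_in_creation_word_span[of w Q] assms(1) by (auto intro!: exI[of _ "set w \<inter> creations"])
  qed
  then show thesis using that by blast
qed

text \<open>
  \<open>P\<close> is the product of \<open>x\<^sup>* x\<close> over \<open>x \<in> N\<close>, where \<open>x\<^sup>*\<close> is the annihilation operator dual to \<open>x\<close>.  Each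
  factor fixes the vacuum, kills the image of \<open>x\<close> because \<open>x x = 0\<close>, and commutes with the other
  creation operators.
\<close>

lemma vacuum_projection:
  assumes "finite N" "N \<subseteq> creations"
  shows "\<exists>P. lin P \<and> P (vac V) = vac V \<and> (\<forall>x\<in>N. \<forall>v. P (act x v) = 0)"
  using assms
proof (induction N)
  case empty
  then show ?case by (intro exI[of _ "\<lambda>v. v"]) (auto intro: linI)
next
  case (insert x N)
  then obtain P where P: "lin P" "P (vac V) = vac V" "\<And>y v. y \<in> N \<Longrightarrow> P (act y v) = 0"
    by auto
  obtain A p where x: "x = (A, p)" "A \<in> labels" "p < 0" using insert.prems by (auto simp: creations_def)
  let ?E = "\<lambda>v. psi A (-1 - p) (psi A p v)"
  have "lin (\<lambda>v. P (?E v))"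
    using P x by (auto intro!: linI simp: lin_add lin_scale psi_simps)
  moreover have "?E (vac V) = vac V"
    using x by (subst psi_anticommute) (auto simp: psi_annihilates_vac psi_simps)
  moreover have "P (?E (act y v)) = 0" if "y \<in> insert x N" for y v
  proof (cases "y = x")
    case True
    have "2 * p \<noteq> -1" by presburger
    then show ?thesis using True x P by (simp add: act_def psi_square psi_simps lin_zero)
  next
    case False
    obtain B q where y: "y = (B, q)" by (cases y)
    have B: "B \<in> labels" "q < 0" using that insert.prems y by (auto simp: creations_def)
    have "A \<noteq> B \<or> -1 - p + q \<noteq> -1" using False x y by auto
    then have "?E (act y v) = act y (?E v)"
      using x B by (auto simp: act_def y psi_simps psi_anticommute[OF x(2) B(1)])
    then show ?thesis using P that False by auto
  qed
  ultimately show ?case using P by (intro exI[of _ "\<lambda>v. P (?E v)"]) auto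
qed

text \<open>
  A word with an odd number of letters of any kind is not empty, so after normal ordering it is killed
  by a vacuum projection.
\<close>

lemma vac_notin_odd_word_span:
  assumes "X \<subseteq> letters"
  shows "vac V \<notin> word_span X Q True"
proof
  assume "vac V \<in> word_span X Q True"
  then obtain N where N: "finite N" "N \<subseteq> X \<inter> creations" "vac V \<in> word_span N Q True"
    using word_span_finite_creation[OF assms] by metis
  obtain P where P: "lin P" "P (vac V) = vac V" "\<And>y v. y \<in> N \<Longrightarrow> P (act y v) = 0"
    using vacuum_projection[OF N(1)] N by auto
  have "P (vac V) \<in> {0}"
  proof (rule word_span_lin_induct[OF P(1) _ N(3)])
    fix w assume "set w \<subseteq> N" "odd_count Q w = True"
    then show "P (word w) \<in> {0}" by (cases w) (auto simp: P)
  qed simp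
  then show False using P vac_nonzero by simp
qed

lemma irreducible_labels:
  assumes "subspace W" "\<And>A p v. A \<in> labels \<Longrightarrow> v \<in> W \<Longrightarrow> psi A p v \<in> W"
  shows "W = {0} \<or> W = UNIV"
  using irreducible[OF assms(1)] assms(2)[of "(_, _)"] by (auto simp: labels_def)

lemma word_span_decomposition: "\<exists>x\<in>word_span letters Q False. \<exists>y\<in>word_span letters Q True. v = x + y"
proof -
  let ?W = "{x + y | x y. x \<in> word_span letters Q False \<and> y \<in> word_span letters Q True}"
  have "?W = {0} \<or> ?W = UNIV"
  proof (rule irreducible_labels)
    show "subspace ?W" by (intro subspace_sums word_span_subspace)
    fix A p v assume A: "A \<in> labels" and "v \<in> ?W"
    then obtain x y where xy: "v = x + y" "x \<in> word_span letters Q False" "y \<in> word_span letters Q True" by auto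
    have "(A, p) \<in> letters" using A by (simp add: letters_def)
    then have "psi A p x \<in> word_span letters Q (A \<in> Q)" "psi A p y \<in> word_span letters Q (A \<notin> Q)"
      using act_word_span[of "(A, p)" letters, OF _ _ xy(2)] act_word_span[of "(A, p)" letters, OF _ _ xy(3)]
      by (auto simp: act_def)
    then show "psi A p v \<in> ?W"
      using A xy(1) by (cases "A \<in> Q") (auto simp: psi_simps intro: add.commute)
  qed
  moreover have "vac V \<in> ?W"
    using vac_in_word_span[of letters Q] subspace_0[OF word_span_subspace, of letters Q True]
    by (intro CollectI exI[of _ "vac V"] exI[of _ 0]) auto
  ultimately have "?W = UNIV" using vac_nonzero by (metis (lifting) singletonD)
  then have "v \<in> ?W" by simp
  then show ?thesis by blast
qed

text \<open>
  A Clifford generator either preserves or exchanges the two spans, so their intersection is invariant;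
  irreducibility leaves \<open>0\<close>, since the vacuum is not in the odd span.
\<close>

lemma word_span_disjoint:
  assumes "v \<in> word_span letters Q False" "v \<in> word_span letters Q True"
  shows "v = 0"
proof -
  let ?W = "word_span letters Q False \<inter> word_span letters Q True"
  have "?W = {0} \<or> ?W = UNIV"
  proof (rule irreducible_labels)
    show "subspace ?W" by (intro subspace_inter word_span_subspace)
    fix A p v assume A: "A \<in> labels" and "v \<in> ?W"
    then have v: "v \<in> word_span letters Q False" "v \<in> word_span letters Q True" by auto
    have "(A, p) \<in> letters" using A by (simp add: letters_def)
    then show "psi A p v \<in> ?W"
      using act_word_span[of "(A, p)" letters, OF _ _ v(1)] act_word_span[of "(A, p)" letters, OF _ _ v(2)]
      by (cases "A \<in> Q") (auto simp: act_def)
  qed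
  moreover have "vac V \<notin> ?W" using vac_notin_odd_word_span[of letters Q] by simp
  ultimately show ?thesis using assms by auto
qed

section \<open>Subalgebras generated by quadratic vectors\<close>

lemma act_eq_mode: "x \<in> letters \<Longrightarrow> act x v = mode V (generator (fst x)) (snd x) v"
  by (cases x) (auto simp: act_def letters_def mode_generator)

lemma word_parity:
  "set w \<subseteq> letters \<Longrightarrow> word w \<in> (if odd (length w) then odd_part V else even_part V)"
proof (induction w)
  case Nil
  then show ?case by (simp add: vac_even)
next
  case (Cons x w)
  then have "generator (fst x) \<in> odd_part V" by (auto intro!: generator_odd simp: letters_def)
  with Cons show ?case
    by (auto simp: act_eq_mode mode_odd_odd mode_odd_even split: if_splits)
qed

lemma word_homogeneous: "set w \<subseteq> letters \<Longrightarrow> word w \<in> homogeneous"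
  using word_parity[of w] by (auto simp: homogeneous_def split: if_splits)

lemma word_Cons_iterate: "x \<in> letters \<Longrightarrow> word (x # w) = mode V (generator (fst x)) (snd x) (word w)"
  by (simp add: act_eq_mode)

lemma mode_word_in_word_span:
  assumes "X = S \<times> UNIV" "S \<subseteq> labels" "set w \<subseteq> X" "c \<in> word_span X Q e"
  shows "mode V (word w) p c \<in> word_span X Q (odd_count Q w \<noteq> e)"
  using assms(3,4)
proof (induction w arbitrary: p c e)
  case Nil
  then show ?case by (simp add: vacuum subspace_0 word_span_subspace)
next
  case (Cons x w)
  have XL: "X \<subseteq> letters" using assms by (auto simp: letters_def)
  have x: "x \<in> X" "x \<in> letters" "fst x \<in> labels" and w: "set w \<subseteq> X" "set w \<subseteq> letters"
    using Cons.prems XL assms(1,2) by auto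
  have step: "mode V (generator (fst x)) q d \<in> word_span X Q ((fst x \<in> Q) \<noteq> f)" if "d \<in> word_span X Q f" for q d f
    using act_word_span[of "(fst x, q)" X, OF _ XL that] x assms(1) by (auto simp: act_def mode_generator)
  show ?case
    unfolding word_Cons_iterate[OF x(2)]
  proof (rule iterate_in_subspace[OF generator_homogeneous[OF x(3)] word_homogeneous[OF w(2)] word_span_subspace])
    fix q r
    have *: "((fst x \<in> Q) \<noteq> (odd_count Q w \<noteq> e)) = (odd_count Q (x # w) \<noteq> e)"
      "(odd_count Q w \<noteq> ((fst x \<in> Q) \<noteq> e)) = (odd_count Q (x # w) \<noteq> e)" by auto
    show "mode V (generator (fst x)) q (mode V (word w) r c) \<in> word_span X Q (odd_count Q (x # w) \<noteq> e)"
      using step[OF Cons.IH[OF w(1) Cons.prems(2)]] * by simp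
    show "mode V (word w) q (mode V (generator (fst x)) r c) \<in> word_span X Q (odd_count Q (x # w) \<noteq> e)"
      using Cons.IH[OF w(1) step[OF Cons.prems(2)]] * by simp
  qed
qed

lemma word_span_vertex_subalgebra:
  assumes "S \<subseteq> labels"
  shows "vertex_subalgebra V (word_span (S \<times> UNIV) Q False)"
proof -
  have "mode V a p b \<in> word_span (S \<times> UNIV) Q False"
    if "a \<in> word_span (S \<times> UNIV) Q False" "b \<in> word_span (S \<times> UNIV) Q False" for a b p
  proof (rule word_span_lin_induct[OF mode_linear_left word_span_subspace that(1)])
    fix w assume "set w \<subseteq> S \<times> (UNIV :: int set)" "odd_count Q w = False"
    then show "mode V (word w) p b \<in> word_span (S \<times> UNIV) Q False"
      using mode_word_in_word_span[OF refl assms, of w b Q False] that by auto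
  qed
  then show ?thesis
    by (simp add: vertex_subalgebra_def word_span_subspace vac_in_word_span)
qed

text \<open>
  The even and odd words lie in the even and odd part respectively and together span the whole space,
  while the two parts meet in \<open>0\<close> only.
\<close>

lemma even_part_eq_word_span: "even_part V = word_span letters UNIV False"
proof
  show *: "word_span letters UNIV False \<subseteq> even_part V"
    using word_parity by (intro word_span_subset even_subspace) (metis odd_count_UNIV)
  have odd: "word_span letters UNIV True \<subseteq> odd_part V"
    using word_parity by (intro word_span_subset odd_subspace) (metis odd_count_UNIV)
  show "even_part V \<subseteq> word_span letters UNIV False"
  proof
    fix v assume v: "v \<in> even_part V"
    obtain x y where xy: "x \<in> word_span letters UNIV False" "y \<in> word_span letters UNIV True" "v = x + y"
      using word_span_decomposition[of UNIV v] by auto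
    then have "v - x \<in> even_part V" using * v by (intro subspace_diff even_subspace) auto
    then have "y \<in> even_part V \<inter> odd_part V" using xy odd by auto
    then show "v \<in> word_span letters UNIV False" using xy even_Int_odd by auto
  qed
qed

lemma word_mode_commute:
  assumes "lin X" "S \<subseteq> labels" "set w \<subseteq> S \<times> UNIV"
    and X: "\<And>A p v. A \<in> S \<Longrightarrow> X (psi A p v) = smul V (\<epsilon> A) (psi A p (X v))"
  shows "X (mode V (word w) q c) = smul V (prod_list (map (\<epsilon> \<circ> fst) w)) (mode V (word w) q (X c))"
  using assms(3)
proof (induction w arbitrary: q c)
  case Nil
  then show ?case using lin_zero[OF assms(1)] by (simp add: vacuum)
next
  case (Cons x w)
  have x: "x \<in> letters" "fst x \<in> labels" "fst x \<in> S" and w: "set w \<subseteq> letters"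
    using Cons.prems assms(2) by (auto simp: letters_def)
  show ?case
    using iterate_commute[OF generator_homogeneous[OF x(2)] word_homogeneous[OF w] assms(1), of "\<epsilon> (fst x)"]
      Cons X x by (simp add: word_Cons_iterate mode_generator del: word_simps)
qed

text \<open>
  Used with \<open>\<epsilon> = -1\<close> for \<open>X\<close> a fermion of another column, and with \<open>\<epsilon> = 1\<close> for \<open>X\<close> a mode of a vector
  of another factor.
\<close>

lemma word_span_mode_commute:
  assumes "lin X" "S \<subseteq> labels" "a \<in> word_span (S \<times> UNIV) UNIV False" "\<epsilon> * \<epsilon> = 1"
    and X: "\<And>A p v. A \<in> S \<Longrightarrow> X (psi A p v) = smul V \<epsilon> (psi A p (X v))"
  shows "X (mode V a q c) = mode V a q (X c)"
proof -
  have "X (mode V a q c) - mode V a q (X c) \<in> {0}"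
  proof (rule word_span_lin_induct[OF _ _ assms(3)])
    show "lin (\<lambda>a. X (mode V a q c) - mode V a q (X c))"
      using assms(1) by (auto intro!: linI simp: mode_left_simps lin_add lin_scale scale_right_diff_distrib)
    fix w assume w: "set w \<subseteq> S \<times> (UNIV :: int set)" "odd_count UNIV w = False"
    have "even (length w)" using w by (simp add: odd_count_UNIV)
    then obtain k where "length w = 2 * k" by (rule evenE)
    then have "prod_list (map ((\<lambda>_. \<epsilon>) \<circ> fst) w) = 1"
      using assms(4) by (simp add: comp_def map_replicate_const power_mult power2_eq_square)
    then show "X (mode V (word w) q c) - mode V (word w) q (X c) \<in> {0}"
      using word_mode_commute[OF assms(1,2) w(1), of "\<lambda>_. \<epsilon>"] X by simp
  qed simp
  then show ?thesis by simp
qed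

text \<open>
  The vector \<open>\<psi>\<^sub>A(p + 1/2) \<psi>\<^sub>B(-1/2) 1\<close>.
\<close>

definition bilinear :: "nat \<times> nat \<Rightarrow> int \<Rightarrow> nat \<times> nat \<Rightarrow> 'v" where
  "bilinear A p B = psi A p (generator B)"

definition quadratics :: "(nat \<times> nat) set \<Rightarrow> 'v set" where
  "quadratics S = {bilinear A (-1) B | A B. A \<in> S \<and> B \<in> S}"

lemma psi_generator_nonneg:
  assumes "A \<in> labels" "B \<in> labels" "p \<ge> 0"
  shows "psi A p (generator B) = (if A = B \<and> p = 0 then vac V else 0)"
  using assms psi_anticommute[OF assms(1,2), of p "-1" "vac V"]
  by (simp add: generator_def psi_annihilates_vac psi_simps)

lemma psi_bilinear_nonneg:
  assumes "A \<in> labels" "B \<in> labels" "C \<in> labels" "p \<ge> 0"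
  shows "psi A p (bilinear B q C) = (if A = B \<and> p + q = -1 then generator C else 0)
    - (if A = C \<and> p = 0 then psi B q (vac V) else 0)"
  unfolding bilinear_def
  by (subst psi_anticommute[OF assms(1,2)])
     (use assms in \<open>simp add: psi_generator_nonneg psi_simps\<close>)

lemma bilinear_mode:
  assumes "A \<in> labels" "B \<in> labels"
  shows "mode V (bilinear A r B) q c =
    Sum_any (\<lambda>i::nat. smul V ((-1) ^ i * (of_int r gchoose i))
      (psi A (r - int i) (psi B (q + int i) c)
       + smul V ((-1) powi r) (psi B (q + r - int i) (psi A (int i) c))))"
proof -
  have "parity_sign V (generator A) (generator B) = -1"
    using assms generator_odd by (simp add: parity_sign_def)
  then show ?thesis
    using iterate_formula[OF generator_homogeneous[OF assms(1)] generator_homogeneous[OF assms(2)], of r q c] assms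
    by (simp add: mode_generator bilinear_def)
qed

context
  fixes S U
  assumes S: "S \<subseteq> labels" and U: "vertex_subalgebra V U" "quadratics S \<subseteq> U"
    and third: "\<And>A B. A \<in> S \<Longrightarrow> B \<in> S \<Longrightarrow> \<exists>C\<in>S. C \<noteq> A \<and> C \<noteq> B"
begin

lemma quadratic_mem: "A \<in> S \<Longrightarrow> B \<in> S \<Longrightarrow> bilinear A (-1) B \<in> U"
  using U(2) unfolding quadratics_def by blast

text \<open>
  In the product of \<open>\<psi>\<^sub>A \<psi>\<^sub>C\<close> and \<open>\<psi>\<^sub>C \<psi>\<^sub>B\<close> the two fields of the third label \<open>C\<close> are contracted, leaving \<open>\<psi>\<^sub>B\<close> and
  the derivative of \<open>\<psi>\<^sub>A\<close>.  The term with four fermions vanishes, as \<open>\<psi>\<^sub>C(-1/2)\<close> occurs twice in it.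
\<close>

lemma bilinear_minus_two:
  assumes "A \<in> S" "B \<in> S" "A \<noteq> B"
  shows "bilinear A (-2) B \<in> U"
proof -
  obtain C where C: "C \<in> S" "C \<noteq> A" "C \<noteq> B" using third[OF assms(1,2)] by auto
  have idx: "A \<in> labels" "B \<in> labels" "C \<in> labels" using assms C S by auto
  have "mode V (bilinear A (-1) C) (-1) (bilinear C (-1) B) \<in> U"
    using vertex_subalgebraD(3)[OF U(1)] quadratic_mem assms C by auto
  also have "mode V (bilinear A (-1) C) (-1) (bilinear C (-1) B) =
    Sum_any (\<lambda>i::nat. psi A (-1 - int i) (psi C (-1 + int i) (bilinear C (-1) B)))"
    using bilinear_mode[OF idx(1,3), of "-1" "-1" "bilinear C (-1) B"] idx assms(3) C
    by (simp add: gchoose_minus_one psi_bilinear_nonneg psi_simps)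
  \<comment> \<open>At \<open>i = 0\<close> the generator \<open>\<psi>\<^sub>C(-1/2)\<close> acts twice; for \<open>i \<ge> 2\<close> it contracts with nothing.\<close>
  also have "\<dots> = psi A (-1 - int 1) (psi C (-1 + int 1) (bilinear C (-1) B))"
  proof (rule Sum_any_single)
    fix i :: nat assume "i \<noteq> 1"
    then show "psi A (-1 - int i) (psi C (-1 + int i) (bilinear C (-1) B)) = 0"
      using idx C psi_square[of C "-1"] 
      by (cases "i = 0") (auto simp: psi_bilinear_nonneg psi_simps, auto simp: bilinear_def psi_simps)
  qed
  also have "\<dots> = bilinear A (-2) B"
    using idx C by (simp add: psi_bilinear_nonneg) (simp add: bilinear_def)
  finally show ?thesis .
qed

text \<open>
  The zero mode of \<open>\<partial>\<psi>\<^sub>A \<psi>\<^sub>C\<close> replaces the field \<open>\<psi>\<^sub>C\<close> by the derivative of \<open>\<psi>\<^sub>A\<close> up to a nonzero factor and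
  leaves \<open>\<psi>\<^sub>B\<close> alone, so it raises the number of derivatives on the first fermion by one.
\<close>

lemma bilinear_distinct:
  assumes "A \<in> S" "B \<in> S" "A \<noteq> B"
  shows "bilinear A (- 1 - int r) B \<in> U"
  using assms
proof (induction r arbitrary: A)
  case 0
  then show ?case by (simp add: quadratic_mem)
next
  case (Suc r)
  obtain C where C: "C \<in> S" "C \<noteq> A" "C \<noteq> B" using third[OF Suc.prems(1,2)] by auto
  have idx: "A \<in> labels" "B \<in> labels" "C \<in> labels" using Suc.prems C S by auto
  let ?v = "bilinear C (- 1 - int r) B"
  let ?g = "\<lambda>i. smul V (of_nat (Suc i)) (psi A (-2 - int i) (psi C (int i) ?v))"
  have "mode V (bilinear A (-2) C) 0 ?v \<in> U"
    using vertex_subalgebraD(3)[OF U(1)] bilinear_minus_two Suc C by auto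
  also have "mode V (bilinear A (-2) C) 0 ?v = Sum_any ?g"
    using bilinear_mode[OF idx(1,3), of "-2" "0" ?v] idx Suc.prems(3) C
    by (simp add: gchoose_minus_two psi_bilinear_nonneg psi_simps del: of_nat_Suc)
  also have "\<dots> = ?g r"
    using idx C Suc.prems by (intro Sum_any_single) (auto simp: psi_bilinear_nonneg psi_simps)
  also have "?g r = smul V (of_nat (Suc r)) (bilinear A (- 1 - int (Suc r)) B)"
    using idx C Suc.prems by (simp add: psi_bilinear_nonneg) (simp add: bilinear_def)
  finally have "smul V (inverse (of_nat (Suc r))) (smul V (of_nat (Suc r)) (bilinear A (- 1 - int (Suc r)) B)) \<in> U"
    by (rule subspace_scale[OF vertex_subalgebraD(1)[OF U(1)]])
  moreover have "(of_nat (Suc r) :: complex) \<noteq> 0" by (rule of_nat_neq_0)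
  ultimately show ?case by (simp only: scale_scale left_inverse scale_one simp_thms)
qed

text \<open>
  For equal labels one starts from distinct labels with one more derivative, and turns \<open>\<psi>\<^sub>B\<close> into \<open>\<psi>\<^sub>A\<close> with the
  mode of \<open>\<psi>\<^sub>A \<psi>\<^sub>B\<close> that lowers the degree by one.
\<close>

lemma bilinear_same:
  assumes "A \<in> S"
  shows "bilinear A (- 1 - int r) A \<in> U"
proof -
  obtain B where B: "B \<in> S" "B \<noteq> A" using third[OF assms assms] by auto
  have idx: "A \<in> labels" "B \<in> labels" using assms B S by auto
  let ?v = "bilinear B (- 1 - int (Suc r)) A"
  let ?g = "\<lambda>i. psi A (-1 - int i) (psi B (1 + int i) ?v) - psi B (- int i) (psi A (int i) ?v)"
  have "mode V (bilinear A (-1) B) 1 ?v \<in> U"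
    using vertex_subalgebraD(3)[OF U(1)] quadratic_mem bilinear_distinct[OF B(1) assms B(2), of "Suc r"] assms B by auto
  also have "mode V (bilinear A (-1) B) 1 ?v = Sum_any ?g"
    using bilinear_mode[OF idx, of "-1" "1" ?v] by (simp add: gchoose_minus_one)
  also have "\<dots> = ?g r"
  proof (rule Sum_any_single)
    fix i assume "i \<noteq> r"
    then show "?g i = 0"
      using idx B psi_anticommute[OF idx(2,2), of "0" "- 1 - int (Suc r)" "vac V"]
      by (auto simp: psi_bilinear_nonneg psi_simps psi_annihilates_vac)
  qed
  also have "\<dots> = bilinear A (- 1 - int r) A"
    using idx B psi_anticommute[OF idx(2,2), of "0" "- 1 - int (Suc r)" "vac V"]
    by (auto simp: psi_bilinear_nonneg psi_simps psi_annihilates_vac) (auto simp: bilinear_def)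
  finally show ?thesis .
qed

lemma bilinear_mem:
  assumes "A \<in> S" "B \<in> S"
  shows "bilinear A p B \<in> U"
proof (cases "p \<ge> 0")
  case True
  have "A \<in> labels" "B \<in> labels" using assms S by blast+
  then show ?thesis using True vertex_subalgebraD(1,2)[OF U(1)]
    by (auto simp: bilinear_def psi_generator_nonneg subspace_0)
next
  case False
  then have "p = - 1 - int (nat (- 1 - p))" by simp
  then show ?thesis using bilinear_same bilinear_distinct assms by (cases "A = B") metis+
qed

lemma psi_psi_mem:
  assumes "A \<in> S" "B \<in> S" "v \<in> U"
  shows "psi A p (psi B q v) \<in> U"
proof -
  have "A \<in> labels" "B \<in> labels" using assms S by blast+
  then show ?thesis
    using product_of_modes_in_subalgebra[OF U(1), of "generator A" "generator B" v p q]
      assms(3) bilinear_mem[OF assms(1,2)]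
    by (simp add: generator_homogeneous mode_generator bilinear_def)
qed

lemma even_words_mem: "word_span (S \<times> UNIV) UNIV False \<subseteq> U"
proof (rule word_span_subset[OF vertex_subalgebraD(1)[OF U(1)]])
  fix w assume "set w \<subseteq> S \<times> (UNIV :: int set)" "odd_count UNIV w = False"
  then show "word w \<in> U"
  proof (induction w rule: induct_list012)
    case 1
    then show ?case using vertex_subalgebraD(2)[OF U(1)] by simp
  next
    case (3 x y w)
    then show ?case by (auto simp: act_def intro!: psi_psi_mem)
  qed auto
qed

end

text \<open>
  Three labels are really required: for one label all quadratic vectors vanish, and for two labels they
  generate only a Heisenberg algebra.
\<close>

lemma generated_quadratics:
  assumes S: "S \<subseteq> labels" and third: "\<And>A B. A \<in> S \<Longrightarrow> B \<in> S \<Longrightarrow> \<exists>C\<in>S. C \<noteq> A \<and> C \<noteq> B"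
  shows "generated_subalgebra V (quadratics S) = word_span (S \<times> UNIV) UNIV False"
proof
  show "generated_subalgebra V (quadratics S) \<subseteq> word_span (S \<times> UNIV) UNIV False"
  proof (rule generated_subalgebra_least[OF word_span_vertex_subalgebra[OF S]])
    have "bilinear A (-1) B = word [(A, -1), (B, -1)]" for A B
      by (simp add: bilinear_def act_def generator_def)
    then show "quadratics S \<subseteq> word_span (S \<times> UNIV) UNIV False"
      by (auto simp: quadratics_def simp del: word_simps intro!: word_in_word_span)
  qed
  show "word_span (S \<times> UNIV) UNIV False \<subseteq> generated_subalgebra V (quadratics S)"
    by (rule even_words_mem[OF S generated_subalgebra_vertex_subalgebra generated_subalgebra_superset third])
qed

section \<open>Sign automorphisms and their fixed points\<close>

lemma all_words_span: "v \<in> word_span letters {} False"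
proof -
  have "word_span letters {} True = {0}" by (simp add: word_span_def)
  then show ?thesis using word_span_decomposition[of "{}" v] by auto
qed

lemma lin_eq_on_words:
  assumes "lin X" "lin Y" "\<And>w. set w \<subseteq> letters \<Longrightarrow> X (word w) = Y (word w)"
  shows "X v = Y v"
proof -
  have "v \<in> span (word ` {w. set w \<subseteq> letters})"
    using all_words_span[of v] by (simp add: word_span_def)
  then show ?thesis by (rule lin_eq_on_span[OF assms(1,2), rotated]) (use assms(3) in auto)
qed

text \<open>
  The linear involution negating the words with an odd number of letters in \<open>Q\<close>.  As words are not linearly
  independent, it is given through the decomposition into the two spans rather than by values on words.
\<close>

definition flip :: "(nat \<times> nat) set \<Rightarrow> 'v \<Rightarrow> 'v" where
  "flip Q v = (THE u. \<exists>x\<in>word_span letters Q False. \<exists>y\<in>word_span letters Q True. v = x + y \<and> u = x - y)"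

lemma flip_eq:
  assumes "x \<in> word_span letters Q False" "y \<in> word_span letters Q True"
  shows "flip Q (x + y) = x - y"
  unfolding flip_def
proof (rule the_equality)
  fix u assume "\<exists>x'\<in>word_span letters Q False. \<exists>y'\<in>word_span letters Q True. x + y = x' + y' \<and> u = x' - y'"
  then obtain x' y' where *: "x' \<in> word_span letters Q False" "y' \<in> word_span letters Q True"
    "x + y = x' + y'" "u = x' - y'" by blast
  have "x - x' = y' - y" using *(3) by (simp add: algebra_simps)
  moreover have "x - x' \<in> word_span letters Q False" "y' - y \<in> word_span letters Q True"
    using assms * by (auto intro: subspace_diff word_span_subspace)
  ultimately have "x - x' = 0" "y' - y = 0" using word_span_disjoint[of "x - x'" Q] by auto
  then show "u = x - y" using * by simp
qed (use assms in blast)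

lemma lin_flip: "lin (flip Q)"
proof (rule linI)
  fix v v' c
  obtain x y where v: "x \<in> word_span letters Q False" "y \<in> word_span letters Q True" "v = x + y"
    using word_span_decomposition[of Q v] by blast
  obtain x' y' where v': "x' \<in> word_span letters Q False" "y' \<in> word_span letters Q True" "v' = x' + y'"
    using word_span_decomposition[of Q v'] by blast
  have "v + v' = (x + x') + (y + y')" using v v' by (simp add: algebra_simps)
  moreover have "flip Q ((x + x') + (y + y')) = (x + x') - (y + y')"
    using v v' by (intro flip_eq subspace_add word_span_subspace)
  ultimately show "flip Q (v + v') = flip Q v + flip Q v'"
    using v v' by (simp add: flip_eq algebra_simps)
  have "flip Q (smul V c x + smul V c y) = smul V c x - smul V c y"
    using v by (intro flip_eq subspace_scale word_span_subspace)
  then show "flip Q (smul V c v) = smul V c (flip Q v)"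
    using v by (simp add: flip_eq scale_right_distrib scale_right_diff_distrib)
qed

lemma flip_word:
  assumes "set w \<subseteq> letters"
  shows "flip Q (word w) = (if odd_count Q w then - word w else word w)"
proof (cases "odd_count Q w")
  case True
  then show ?thesis
    using flip_eq[of 0 Q "word w"] word_in_word_span[OF assms, of Q True] subspace_0[OF word_span_subspace] by simp
next
  case False
  then show ?thesis
    using flip_eq[of "word w" Q 0] word_in_word_span[OF assms, of Q False] subspace_0[OF word_span_subspace] by simp
qed

lemma flip_flip: "flip Q (flip Q v) = v"
  by (rule lin_eq_on_words[OF lin_comp[OF lin_flip lin_flip]])
     (auto intro: linI simp: flip_word lin_neg[OF lin_flip])

lemma flip_psi:
  assumes "A \<in> labels"
  shows "flip Q (psi A p v) = smul V (if A \<in> Q then -1 else 1) (psi A p (flip Q v))"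
proof (rule lin_eq_on_words[where v = v and X = "\<lambda>v. flip Q (psi A p v)"
      and Y = "\<lambda>v. smul V (if A \<in> Q then -1 else 1) (psi A p (flip Q v))"])
  show "lin (\<lambda>v. flip Q (psi A p v))" by (rule lin_comp[OF lin_flip lin_psi[OF assms]])
  show "lin (\<lambda>v. smul V (if A \<in> Q then -1 else 1) (psi A p (flip Q v)))"
    using assms by (auto intro!: linI simp: psi_simps lin_add[OF lin_flip] lin_scale[OF lin_flip])
  fix w assume w: "set w \<subseteq> letters"
  then have "flip Q (word ((A, p) # w)) =
      (if odd_count Q ((A, p) # w) then - word ((A, p) # w) else word ((A, p) # w))"
    using assms by (intro flip_word) (auto simp: letters_def)
  then show "flip Q (psi A p (word w)) = smul V (if A \<in> Q then -1 else 1) (psi A p (flip Q (word w)))"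
    using assms by (simp add: flip_word[OF w] act_def psi_simps)
qed

lemma flip_even:
  assumes "v \<in> even_part V"
  shows "flip Q v \<in> even_part V"
  unfolding even_part_eq_word_span
proof (rule word_span_lin_induct[OF lin_flip word_span_subspace assms[unfolded even_part_eq_word_span]])
  fix w assume "set w \<subseteq> letters" "odd_count UNIV w = False"
  then show "flip Q (word w) \<in> word_span letters UNIV False"
    using word_in_word_span[of w letters UNIV False] subspace_neg[OF word_span_subspace] by (simp add: flip_word)
qed

lemma flip_mode:
  assumes "a \<in> even_part V"
  shows "flip Q (mode V a p b) = mode V (flip Q a) p (flip Q b)"
proof -
  have "flip Q (mode V a p b) - mode V (flip Q a) p (flip Q b) \<in> {0}"
  proof (rule word_span_lin_induct[OF _ _ assms[unfolded even_part_eq_word_span]])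
    show "lin (\<lambda>a. flip Q (mode V a p b) - mode V (flip Q a) p (flip Q b))"
      by (auto intro!: linI simp: lin_add[OF lin_flip] lin_scale[OF lin_flip] mode_left_simps
          scale_right_diff_distrib)
    fix w assume w: "set w \<subseteq> letters"
    let ?\<epsilon> = "\<lambda>A. if A \<in> Q then -1 else 1 :: complex"
    have "prod_list (map (?\<epsilon> \<circ> fst) w) = (if odd_count Q w then -1 else 1)"
      by (induction w) auto
    then show "flip Q (mode V (word w) p b) - mode V (flip Q (word w)) p (flip Q b) \<in> {0}"
      using word_mode_commute[OF lin_flip subset_refl w[unfolded letters_def], of Q ?\<epsilon>] flip_psi w
      by (simp add: flip_word mode_left_simps)
  qed simp
  then show ?thesis by simp
qed

lemma flip_vac: "flip Q (vac V) = vac V"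
  using flip_word[of "[]"] by simp

definition column :: "nat \<Rightarrow> (nat \<times> nat) set" where
  "column j = {1..K} \<times> {j}"

text \<open>
  Automorphisms of the even part are \<open>undefined\<close> outside it, hence the restriction.
\<close>

definition flip_aut :: "nat \<Rightarrow> 'v \<Rightarrow> 'v" where
  "flip_aut i = restrict (flip (column i)) (even_part V)"

lemma flip_aut_automorphism: "flip_aut i \<in> vertex_automorphisms V (even_part V)"
proof -
  have "bij_betw (flip_aut i) (even_part V) (even_part V)"
    by (rule bij_betw_byWitness[where f' = "flip_aut i"])
       (auto simp: flip_aut_def flip_even flip_flip)
  moreover note U = vertex_subalgebraD[OF even_part_vertex_subalgebra]
  ultimately show ?thesis
    using flip_mode lin_add[OF lin_flip] lin_scale[OF lin_flip] flip_vac
    by (auto simp: vertex_automorphisms_def Bij_def flip_aut_def U(2,3)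
        subspace_add[OF U(1)] subspace_scale[OF U(1)])
qed

text \<open>
  The vectors on which two automorphisms agree form a vertex subalgebra.
\<close>

lemma automorphisms_eqI:
  assumes f: "f \<in> vertex_automorphisms V U" and g: "g \<in> vertex_automorphisms V U"
    and U: "vertex_subalgebra V U" "U = generated_subalgebra V S"
    and eq: "\<And>x. x \<in> S \<Longrightarrow> f x = g x"
  shows "f = g"
proof -
  have hom: "h (vac V) = vac V" "\<And>a b. a \<in> U \<Longrightarrow> b \<in> U \<Longrightarrow> h (a + b) = h a + h b"
    "\<And>a c. a \<in> U \<Longrightarrow> h (smul V c a) = smul V c (h a)"
    "\<And>a b p. a \<in> U \<Longrightarrow> b \<in> U \<Longrightarrow> h (mode V a p b) = mode V (h a) p (h b)"
    if "h \<in> vertex_automorphisms V U" for h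
    using that by (auto simp: vertex_automorphisms_def)
  note UU = vertex_subalgebraD[OF U(1)]
  have "f 0 = g 0"
    using hom(3)[OF f UU(2), of 0] hom(3)[OF g UU(2), of 0] by simp
  then have "vertex_subalgebra V {v \<in> U. f v = g v}"
    using UU hom[OF f] hom[OF g] by (auto simp: vertex_subalgebra_def subspace_def)
  moreover have "S \<subseteq> {v \<in> U. f v = g v}"
    using eq generated_subalgebra_superset[of S] U(2) by auto
  ultimately have "U \<subseteq> {v \<in> U. f v = g v}"
    using generated_subalgebra_least[of _ S] U(2) by simp
  moreover have "f \<in> extensional U" "g \<in> extensional U"
    using f g by (auto simp: vertex_automorphisms_def Bij_def)
  ultimately show ?thesis by (intro extensionalityI[of f U g]) auto
qed

lemma bilinear_eq_quadratic: "bilinear (k, i) (-1) (l, j) = psi_quadratic V \<psi> k i l j"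
  by (simp add: bilinear_def generator_def psi_quadratic_def)

lemma third_label:
  assumes "K \<ge> 3" "A \<in> {1..K} \<times> J" "B \<in> {1..K} \<times> J"
  shows "\<exists>C\<in>{1..K} \<times> J. C \<noteq> A \<and> C \<noteq> B"
proof -
  have "\<not> {1, 2, 3} \<subseteq> {fst A, fst B}"
    using card_mono[of "{fst A, fst B}" "{1, 2, 3::nat}"] card_insert_le_m1[of 2 "{fst B}" "fst A"] by auto
  then obtain c where "c \<in> {1, 2, 3}" "c \<noteq> fst A" "c \<noteq> fst B" by blast
  then show ?thesis using assms by (intro bexI[of _ "(c, snd A)"]) auto
qed

lemma even_part_generated:
  assumes "K \<ge> 3"
  shows "even_part V = generated_subalgebra V (quadratics labels)"
  using generated_quadratics[of labels] third_label[OF assms, of _ "{1..n}"]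
  by (simp add: labels_def even_part_eq_word_span letters_def)

lemma column_subset_labels: "j \<in> {1..n} \<Longrightarrow> column j \<subseteq> labels"
  by (auto simp: column_def labels_def)

lemma quadratics_column: "quadratics (column j) = {psi_quadratic V \<psi> k j l j | k l. k \<in> {1..K} \<and> l \<in> {1..K}}"
  by (auto simp: quadratics_def column_def bilinear_eq_quadratic)

lemma factor_eq_word_span:
  assumes "K \<ge> 3" "j \<in> {1..n}"
  shows "so_level_one_factor V \<psi> K j = word_span (column j \<times> UNIV) UNIV False"
  using generated_quadratics[OF column_subset_labels[OF assms(2)]] third_label[OF assms(1), of _ "{j}"]
  unfolding so_level_one_factor_def quadratics_column[symmetric] by (simp add: column_def)

text \<open>
  The definite description in \<open>sigma\<close> denotes the sign automorphism: that one takes the prescribed values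
  on quadratic vectors, and these generate the even part.
\<close>

lemma sigma_eq_flip_aut:
  assumes "K \<ge> 3" "i \<in> {1..n}"
  shows "sigma V \<psi> K n i = flip_aut i"
  unfolding sigma_def so_level_one_def
proof (rule the_equality, intro conjI ballI)
  have flip_quad: "flip_aut i (psi_quadratic V \<psi> k j r s) =
       smul V ((-1) ^ (of_bool (i = j) + of_bool (i = s))) (psi_quadratic V \<psi> k j r s)"
    if "k \<in> {1..K}" "r \<in> {1..K}" "j \<in> {1..n}" "s \<in> {1..n}" for k r j s
  proof -
    let ?w = "[((k, j), -1), ((r, s), -1)]"
    have w: "set ?w \<subseteq> letters" using that by (auto simp: letters_def labels_def)
    have q: "psi_quadratic V \<psi> k j r s = word ?w"
      by (simp add: psi_quadratic_def act_def)
    have "word ?w \<in> even_part V" using word_parity[OF w] by simp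
    then show ?thesis
      using that flip_word[OF w, of "column i"] unfolding q flip_aut_def
      by (auto simp: column_def simp del: word_simps)
  qed
  then show "flip_aut i (psi_quadratic V \<psi> k j r s) =
       smul V ((-1) ^ (of_bool (i = j) + of_bool (i = s))) (psi_quadratic V \<psi> k j r s)"
    if "k \<in> {1..K}" "r \<in> {1..K}" "j \<in> {1..n}" "s \<in> {1..n}" for k r j s
    using that by blast
  show "flip_aut i \<in> vertex_automorphisms V (even_part V)" by (rule flip_aut_automorphism)
  fix f
  assume f: "f \<in> vertex_automorphisms V (even_part V) \<and>
    (\<forall>k\<in>{1..K}. \<forall>r\<in>{1..K}. \<forall>j\<in>{1..n}. \<forall>s\<in>{1..n}.
       f (psi_quadratic V \<psi> k j r s) =
       smul V ((-1) ^ (of_bool (i = j) + of_bool (i = s))) (psi_quadratic V \<psi> k j r s))"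
  show "f = flip_aut i"
  proof (rule automorphisms_eqI[OF _ flip_aut_automorphism even_part_vertex_subalgebra
        even_part_generated[OF assms(1)]])
    fix x assume "x \<in> quadratics labels"
    then obtain k j r s where "k \<in> {1..K}" "r \<in> {1..K}" "j \<in> {1..n}" "s \<in> {1..n}"
      "x = psi_quadratic V \<psi> k j r s"
      by (auto simp: quadratics_def labels_def bilinear_eq_quadratic)
    then show "f x = flip_aut i x" using f flip_quad by simp
  qed (use f in blast)
qed

text \<open>
  Vectors fixed by the generators are fixed by the generated group.  Only the inverses need an argument: \<open>m_inv\<close> is a
  definite description, and an involution is its own unique inverse.
\<close>

lemma fixed_points_sigma_group:
  assumes "K \<ge> 3"
  shows "fixed_points (so_level_one V) (sigma_group V \<psi> K n)
    = fixed_points (even_part V) (flip_aut ` {1..n})"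
proof -
  let ?G = "vertex_aut_group V (even_part V)"
  have H: "sigma V \<psi> K n ` {1..n} = flip_aut ` {1..n}"
    using sigma_eq_flip_aut[OF assms] by (intro image_cong refl)
  have G: "sigma_group V \<psi> K n = generate ?G (flip_aut ` {1..n})"
    unfolding sigma_group_def H so_level_one_def ..
  have inv: "inv\<^bsub>?G\<^esub> (flip_aut i) = flip_aut i" for i
  proof -
    have sq: "flip_aut i \<otimes>\<^bsub>?G\<^esub> flip_aut i = \<one>\<^bsub>?G\<^esub>"
      using flip_aut_automorphism[of i]
      by (auto simp: vertex_aut_group_def BijGroup_def vertex_automorphisms_def compose_def
          flip_aut_def flip_even flip_flip fun_eq_iff)
    show ?thesis
      unfolding m_inv_def
    proof (rule the_equality)
      show "flip_aut i \<in> carrier ?G \<and> flip_aut i \<otimes>\<^bsub>?G\<^esub> flip_aut i = \<one>\<^bsub>?G\<^esub> \<and>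
          flip_aut i \<otimes>\<^bsub>?G\<^esub> flip_aut i = \<one>\<^bsub>?G\<^esub>"
        using sq flip_aut_automorphism by (simp add: vertex_aut_group_def)
      fix g assume g: "g \<in> carrier ?G \<and> flip_aut i \<otimes>\<^bsub>?G\<^esub> g = \<one>\<^bsub>?G\<^esub> \<and> g \<otimes>\<^bsub>?G\<^esub> flip_aut i = \<one>\<^bsub>?G\<^esub>"
      then have gB: "g \<in> Bij (even_part V)" "flip_aut i \<in> Bij (even_part V)"
        using flip_aut_automorphism by (auto simp: vertex_aut_group_def vertex_automorphisms_def)
      then have "compose (even_part V) g (flip_aut i) = (\<lambda>x\<in>even_part V. x)"
        using g by (simp add: vertex_aut_group_def BijGroup_def)
      then have *: "g (flip_aut i x) = x" if "x \<in> even_part V" for x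
        using that by (metis compose_eq restrict_apply')
      have "g x = flip_aut i x" if "x \<in> even_part V" for x
        using *[of "flip_aut i x"] that by (simp add: flip_aut_def flip_even flip_flip)
      then show "g = flip_aut i"
        using gB by (intro extensionalityI[of g "even_part V"]) (auto simp: Bij_def)
    qed
  qed
  have fixed: "g v = v"
    if "v \<in> fixed_points (even_part V) (flip_aut ` {1..n})" "g \<in> generate ?G (flip_aut ` {1..n})" for v g
  proof -
    have v: "v \<in> even_part V" "\<And>i. i \<in> {1..n} \<Longrightarrow> flip_aut i v = v"
      using that(1) by (auto simp: fixed_points_def)
    have "g \<in> Bij (even_part V) \<and> g v = v" using that(2)
    proof (induction g rule: generate.induct)
      case one
      then show ?case using v(1) id_Bij[of "even_part V"]
        by (simp add: vertex_aut_group_def BijGroup_def restrict_def)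
    next
      case (incl h)
      then show ?case using v flip_aut_automorphism by (auto simp: vertex_automorphisms_def)
    next
      case (inv h)
      then show ?case using v flip_aut_automorphism \<open>\<And>i. inv\<^bsub>?G\<^esub> (flip_aut i) = flip_aut i\<close>
        by (auto simp: vertex_automorphisms_def)
    next
      case (eng h1 h2)
      then show ?case using v(1)
        by (simp add: vertex_aut_group_def BijGroup_def compose_Bij compose_eq)
    qed
    then show ?thesis by simp
  qed
  show ?thesis
  proof
    show "fixed_points (so_level_one V) (sigma_group V \<psi> K n)
        \<subseteq> fixed_points (even_part V) (flip_aut ` {1..n})"
      by (auto simp: fixed_points_def so_level_one_def G intro: generate.incl)
    show "fixed_points (even_part V) (flip_aut ` {1..n})
        \<subseteq> fixed_points (so_level_one V) (sigma_group V \<psi> K n)"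
      using fixed by (auto simp: fixed_points_def so_level_one_def G)
  qed
qed

definition even_words :: "nat set \<Rightarrow> ((nat \<times> nat) \<times> int) list set" where
  "even_words J = {w. set w \<subseteq> letters \<and> (\<forall>j\<in>J. \<not> odd_count (column j) w)}"

text \<open>
  A vector fixed by \<open>flip\<close> is fixed by \<open>(1 + flip)/2\<close>, which keeps the words that are even in the column and
  kills the others.  One column is treated at a time.
\<close>

lemma fixed_in_even_words:
  assumes "finite J" "\<And>j. j \<in> J \<Longrightarrow> flip (column j) v = v"
  shows "v \<in> span (word ` even_words J)"
  using assms
proof (induction J)
  case empty
  then show ?case using all_words_span[of v] by (simp add: word_span_def even_words_def)
next
  case (insert j J)
  let ?P = "\<lambda>v. smul V (1/2) (v + flip (column j) v)"
  have half: "smul V (1/2) (x + x) = x" for x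
    using scale_left_distrib[of "1/2" "1/2" x] by (simp add: scale_right_distrib)
  have "?P v \<in> span (word ` even_words (insert j J))"
  proof (rule lin_span_subset[where X = ?P])
    show "lin ?P"
      by (auto intro!: linI simp: lin_add[OF lin_flip] lin_scale[OF lin_flip] scale_right_distrib mult_ac)
    fix x assume "x \<in> word ` even_words J"
    then obtain w where w: "x = word w" "w \<in> even_words J" by blast
    show "?P x \<in> span (word ` even_words (insert j J))"
    proof (cases "odd_count (column j) w")
      case True
      then show ?thesis using w by (simp add: flip_word even_words_def span_zero)
    next
      case False
      then have "w \<in> even_words (insert j J)" "?P x = x"
        using w by (auto simp: flip_word even_words_def half)
      then show ?thesis using w by (auto intro: span_base)
    qed
  qed (use insert in auto)
  then show ?case using insert.prems half by simp
qed

lemma move_left: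
  assumes "set u \<subseteq> letters" "x \<in> letters" "fst x \<notin> fst ` set u"
  shows "word (u @ x # w) = word (x # u @ w) \<or> word (u @ x # w) = - word (x # u @ w)"
  using assms
proof (induction u)
  case (Cons y u)
  obtain A p B q where xy: "x = (A, p)" "y = (B, q)" by (cases x, cases y)
  have AB: "A \<in> labels" "B \<in> labels" "A \<noteq> B" using Cons.prems xy by (auto simp: letters_def)
  have "act y (act x (word (u @ w))) = - act x (act y (word (u @ w)))"
    using psi_anticommute[of B A q p] AB by (auto simp: act_def xy)
  then show ?case
    using Cons AB by (auto simp: lin_neg[OF lin_act])
qed auto

text \<open>
  If the first letter belongs to column \<open>j\<close>, the next letter of that column is brought next to it;
  this costs a sign only, as the letters in between have other labels.  The remaining word is
  shorter by two and again even in every column.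
\<close>

lemma even_word_mem:
  assumes W: "subspace W" "vac V \<in> W"
    and closed: "\<And>j A B p q v. j \<in> {1..n} \<Longrightarrow> A \<in> column j \<Longrightarrow> B \<in> column j \<Longrightarrow> v \<in> W
      \<Longrightarrow> psi A p (psi B q v) \<in> W"
    and w: "w \<in> even_words {1..n}"
  shows "word w \<in> W"
  using w
proof (induction w rule: length_induct)
  case (1 w)
  show ?case
  proof (cases w)
    case Nil
    then show ?thesis using W by simp
  next
    case (Cons x w')
    obtain A p where x: "x = (A, p)" by (cases x)
    have xL: "set w' \<subseteq> letters" "x \<in> letters" using 1 Cons by (auto simp: even_words_def)
    define j where "j = snd A"
    have j: "j \<in> {1..n}" "A \<in> column j" using xL x by (auto simp: letters_def labels_def column_def j_def)
    have "odd_count (column j) w'" using 1 Cons j x by (auto simp: even_words_def)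
    then have "\<exists>y\<in>set w'. fst y \<in> column j"
      by (auto simp: odd_count_def filter_empty_conv dest: odd_pos)
    then obtain u y w'' where split: "w' = u @ y # w''" "fst y \<in> column j" "\<forall>z\<in>set u. fst z \<notin> column j"
      using split_list_first_prop[of w' "\<lambda>y. fst y \<in> column j"] by blast
    have L: "set u \<subseteq> letters" "set w'' \<subseteq> letters" "y \<in> letters" using xL split by auto
    have "odd_count (column i) w \<longleftrightarrow> odd_count (column i) (u @ w'')" if "i \<in> {1..n}" for i
    proof -
      have "A \<in> column i \<longleftrightarrow> fst y \<in> column i"
        using j split(2) by (auto simp: column_def)
      then show ?thesis by (auto simp: Cons split x odd_count_append)
    qed
    then have "u @ w'' \<in> even_words {1..n}" using 1(2) L by (auto simp: even_words_def)
    then have "word (u @ w'') \<in> W" using 1(1) by (auto simp: Cons split)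
    then have "act x (word (y # u @ w'')) \<in> W"
      using closed[OF j(1) j(2) split(2)] by (simp add: act_def x)
    moreover have "fst y \<notin> fst ` set u" using split by auto
    then have "word w = act x (word (y # u @ w'')) \<or> word w = - act x (word (y # u @ w''))"
      using move_left[OF L(1,3), of w''] lin_neg[OF lin_act[OF xL(2)]]
      by (auto simp: Cons split)
    ultimately show ?thesis using W(1) by (auto intro: subspace_neg)
  qed
qed

lemma column_modes_closed:
  assumes "K \<ge> 3" "j \<in> {1..n}" "vertex_subalgebra V W" "so_level_one_factor V \<psi> K j \<subseteq> W"
    and "A \<in> column j" "B \<in> column j" "v \<in> W"
  shows "psi A p (psi B q v) \<in> W"
proof (rule psi_psi_mem[OF column_subset_labels[OF assms(2)] assms(3) _ _ assms(5-7)])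
  show "quadratics (column j) \<subseteq> W"
    using assms(4) generated_subalgebra_superset[of "quadratics (column j)"]
    by (auto simp: so_level_one_factor_def quadratics_column)
  show "\<exists>C\<in>column j. C \<noteq> A \<and> C \<noteq> B" if "A \<in> column j" "B \<in> column j" for A B
    using third_label[OF assms(1), of A "{j}" B] that by (simp add: column_def)
qed

text \<open>
  The fixed points are spanned by words built from pairs of letters of one column, and every subalgebra
  containing the factors is closed under such pairs.
\<close>

lemma fixed_points_eq_generated:
  assumes "K \<ge> 3"
  shows "fixed_points (even_part V) (flip_aut ` {1..n})
    = generated_subalgebra V (\<Union>j\<in>{1..n}. so_level_one_factor V \<psi> K j)" (is "?F = ?W")
proof
  have W: "vertex_subalgebra V ?W" by (rule generated_subalgebra_vertex_subalgebra)
  have factor: "so_level_one_factor V \<psi> K j \<subseteq> ?W" if "j \<in> {1..n}" for j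
    using generated_subalgebra_superset[of "\<Union>j\<in>{1..n}. so_level_one_factor V \<psi> K j"] that by blast
  show "?F \<subseteq> ?W"
  proof
    fix v assume "v \<in> ?F"
    then have "v \<in> span (word ` even_words {1..n})"
      by (intro fixed_in_even_words) (auto simp: fixed_points_def flip_aut_def)
    moreover have "span (word ` even_words {1..n}) \<subseteq> ?W"
    proof (rule span_minimal[OF _ vertex_subalgebraD(1)[OF W]], safe)
      fix w assume "w \<in> even_words {1..n}"
      then show "word w \<in> ?W"
        by (rule even_word_mem[OF vertex_subalgebraD(1,2)[OF W]
            column_modes_closed[OF assms _ W factor], rotated -1]) auto
    qed
    ultimately show "v \<in> ?W" by blast
  qed
  show "?W \<subseteq> ?F"
  proof (rule generated_subalgebra_least)
    show F: "vertex_subalgebra V ?F"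
      using flip_aut_automorphism
      by (intro fixed_points_vertex_subalgebra even_part_vertex_subalgebra) auto
    show "(\<Union>j\<in>{1..n}. so_level_one_factor V \<psi> K j) \<subseteq> ?F"
    proof (rule UN_least)
      fix j assume j: "j \<in> {1..n}"
      have "quadratics (column j) \<subseteq> ?F"
      proof
        fix x assume "x \<in> quadratics (column j)"
        then obtain A B where AB: "A \<in> column j" "B \<in> column j" "x = word [(A, -1), (B, -1)]"
          by (auto simp: quadratics_def bilinear_def generator_def act_def)
        then have w: "set [(A, - 1 :: int), (B, -1)] \<subseteq> letters"
          using column_subset_labels[OF j] by (auto simp: letters_def)
        have "A \<in> column i \<longleftrightarrow> B \<in> column i" for i using AB by (auto simp: column_def)
        then show "x \<in> ?F"
          using flip_word[OF w] word_parity[OF w]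
          by (auto simp: fixed_points_def flip_aut_def AB(3) simp del: word_simps)
      qed
      then show "so_level_one_factor V \<psi> K j \<subseteq> ?F"
        unfolding so_level_one_factor_def quadratics_column[symmetric]
        by (rule generated_subalgebra_least[OF F])
    qed
  qed
qed

lemma diagonal_subset:
  assumes "vertex_subalgebra V W" "\<And>j. j \<in> {1..n} \<Longrightarrow> so_level_one_factor V \<psi> K j \<subseteq> W"
  shows "so_diagonal V \<psi> K n \<subseteq> W"
  unfolding so_diagonal_def
proof (rule generated_subalgebra_least[OF assms(1)], safe)
  fix k l assume "k \<in> {1..K}" "l \<in> {1..K}"
  then have "psi_quadratic V \<psi> k j l j \<in> so_level_one_factor V \<psi> K j" for j
    using generated_subalgebra_superset[of "quadratics (column j)"]
    unfolding so_level_one_factor_def quadratics_column by blast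
  then show "(\<Sum>j=1..n. psi_quadratic V \<psi> k j l j) \<in> W"
    using assms(2) by (intro subspace_sum vertex_subalgebraD(1)[OF assms(1)]) blast
qed

section \<open>Realizing linear forms by Clifford operators\<close>

lemma creation_span_insert:
  assumes "insert x N \<subseteq> creations" "v \<in> word_span (insert x N) {} False"
  shows "\<exists>u\<in>word_span N {} False. \<exists>u'\<in>word_span N {} False. v = u + act x u'"
proof -
  let ?W = "word_span N {} False"
  have xL: "x \<in> letters" and NL: "N \<subseteq> letters" using assms creations_subset_letters by auto
  let ?U = "{u + u' | u u'. u \<in> ?W \<and> u' \<in> act x ` ?W}"
  have U: "subspace ?U"
  proof (rule subspace_sums[OF word_span_subspace])
    show "subspace (act x ` ?W)"
      unfolding subspace_def
    proof (safe)
      show "0 \<in> act x ` ?W"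
        using lin_zero[OF lin_act[OF xL]] subspace_0[OF word_span_subspace] by (metis imageI)
      show "act x u + act x u' \<in> act x ` ?W" if "u \<in> ?W" "u' \<in> ?W" for u u'
        using lin_add[OF lin_act[OF xL]] subspace_add[OF word_span_subspace that] by (metis imageI)
      show "smul V c (act x u) \<in> act x ` ?W" if "u \<in> ?W" for u c
        using lin_scale[OF lin_act[OF xL]] subspace_scale[OF word_span_subspace that] by (metis imageI)
    qed
  qed
  have "v \<in> ?U"
  proof (rule subsetD[OF word_span_subset[OF U] assms(2)])
    fix w assume "set w \<subseteq> insert x N"
    then have "\<exists>u\<in>?W. \<exists>u'\<in>?W. word w = u + act x u'"
    proof (induction w)
      case Nil
      show ?case
        using vac_in_word_span[of N "{}"] subspace_0[OF word_span_subspace, of N "{}" False]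
          lin_zero[OF lin_act[OF xL]] by (intro bexI[of _ "vac V"] bexI[of _ 0]) auto
    next
      case (Cons y w)
      then obtain u u' where u: "u \<in> ?W" "u' \<in> ?W" "word w = u + act x u'" by auto
      have yL: "y \<in> letters" using Cons.prems xL NL by auto
      obtain A p B q where xy: "x = (A, p)" "y = (B, q)" by (cases x, cases y)
      have AB: "A \<in> labels" "B \<in> labels" "p < 0" "q < 0" using assms(1) Cons.prems xy by (auto simp: creations_def)
      show ?case
      proof (cases "y = x")
        case True
        have "2 * p \<noteq> -1" by presburger
        then have "act x (act x u') = 0" using psi_square[OF AB(1)] by (simp add: act_def xy)
        then have "word (y # w) = 0 + act x u"
          using True u lin_add[OF lin_act[OF xL]] by simp
        then show ?thesis using u subspace_0[OF word_span_subspace] by blast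
      next
        case False
        then have yN: "y \<in> N" using Cons.prems by auto
        have "act y (act x u') = - act x (act y u')"
          using psi_anticommute[OF AB(2,1), of q p u'] AB by (auto simp: act_def xy)
        then have "word (y # w) = act y u + act x (- act y u')"
          using u lin_add[OF lin_act[OF yL]] lin_neg[OF lin_act[OF xL]] by simp
        moreover have "act y u \<in> ?W" "- act y u' \<in> ?W"
          using act_word_span[OF yN NL, of _ "{}" False, simplified] u by (auto intro: subspace_neg[OF word_span_subspace])
        ultimately show ?thesis by blast
      qed
    qed
    then show "word w \<in> ?U" by blast
  qed
  then show ?thesis by blast
qed

text \<open>
  The index \<open>-1 - p\<close> is the one that pairs nontrivially with \<open>p\<close> in the Clifford relation, so the operator is the
  annihilation operator dual to the creation operator \<open>(A, p)\<close>.
\<close>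

lemma dual_letter_kills:
  assumes "(A, p) \<in> creations" "N \<subseteq> creations" "(A, p) \<notin> N" "u \<in> word_span N {} False"
  shows "psi A (-1 - p) u = 0"
proof -
  have A: "A \<in> labels" "p < 0" using assms by (auto simp: creations_def)
  have "psi A (-1 - p) u \<in> {0}"
  proof (rule word_span_lin_induct[OF lin_psi[OF A(1)] _ assms(4)])
    fix w assume "set w \<subseteq> N"
    then show "psi A (-1 - p) (word w) \<in> {0}"
    proof (induction w)
      case Nil
      then show ?case using A by (simp add: psi_annihilates_vac)
    next
      case (Cons y w)
      obtain B q where y: "y = (B, q)" by (cases y)
      have B: "B \<in> labels" "\<not> (A = B \<and> -1 - p + q = -1)"
        using Cons.prems assms y by (auto simp: creations_def)
      then show ?case
        using Cons psi_anticommute[OF A(1) B(1), of "-1 - p" q "word w"]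
        by (auto simp: act_def y psi_simps)
    qed
  qed simp
  then show ?thesis by simp
qed

text \<open>
  A form of Jacobson density, by induction on \<open>N\<close>.  Let \<open>x\<close> be a new creation operator and \<open>v = u + x u'\<close>, where
  \<open>u\<close> and \<open>u'\<close> involve only the creation operators in \<open>N\<close>.  The dual operator
  \<open>x\<^sup>*\<close> gives \<open>x\<^sup>* x v = u\<close> and \<open>x\<^sup>* v = u'\<close>.  Hence \<open>D = D\<^sub>1 x\<^sup>* x + D\<^sub>2 x\<^sup>*\<close> works, where \<open>D\<^sub>1\<close> and \<open>D\<^sub>2\<close> realize the
  forms \<open>f\<close> and \<open>f \<circ> x\<close> on the words in \<open>N\<close>.  The last clause records that \<open>D\<close> is made of operators with labels in
  \<open>S\<close>, without introducing the algebra they generate.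
\<close>

lemma density:
  assumes "finite N" "N \<subseteq> creations" "N \<subseteq> S \<times> UNIV" "form f"
  shows "\<exists>D. lin D \<and> (\<forall>v\<in>word_span N {} False. D v = smul V (f v) (vac V)) \<and>
    (\<forall>X. lin X \<longrightarrow> (\<forall>A\<in>S. \<forall>p v. X (psi A p v) = psi A p (X v)) \<longrightarrow> (\<forall>v. D (X v) = X (D v)))"
  using assms
proof (induction N arbitrary: f)
  case empty
  have "f v = f (vac V) * c" "v = smul V c (vac V)" if "v = smul V c (vac V)" for v c
    using form_scale[OF empty.prems(3)] that by simp_all
  moreover have "word_span {} {} False = range (\<lambda>c. smul V c (vac V))"
  proof -
    have "word ` {w. set w \<subseteq> {} \<and> odd_count {} w = False} = {vac V}" by auto
    then show ?thesis by (simp add: word_span_def span_singleton)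
  qed
  ultimately have "\<forall>v\<in>word_span {} {} False. smul V (f (vac V)) v = smul V (f v) (vac V)" by auto
  moreover have "lin (smul V (f (vac V)))"
    by (rule linI) (simp_all add: scale_right_distrib mult.commute)
  ultimately show ?case by (intro exI[of _ "smul V (f (vac V))"]) (simp add: lin_scale)
next
  case (insert x N)
  obtain A p where x: "x = (A, p)" by (cases x)
  have A: "A \<in> labels" "p < 0" "A \<in> S" "(A, p) \<in> creations" using insert.prems x by (auto simp: creations_def)
  let ?d = "psi A (-1 - p)" and ?c = "psi A p"
  obtain D1 where D1: "lin D1" "\<And>v. v \<in> word_span N {} False \<Longrightarrow> D1 v = smul V (f v) (vac V)"
    "\<And>X v. lin X \<Longrightarrow> (\<forall>A\<in>S. \<forall>p v. X (psi A p v) = psi A p (X v)) \<Longrightarrow> D1 (X v) = X (D1 v)"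
    using insert.IH[OF _ _ insert.prems(3)] insert.prems by auto
  obtain D2 where D2: "lin D2" "\<And>v. v \<in> word_span N {} False \<Longrightarrow> D2 v = smul V (f (?c v)) (vac V)"
    "\<And>X v. lin X \<Longrightarrow> (\<forall>A\<in>S. \<forall>p v. X (psi A p v) = psi A p (X v)) \<Longrightarrow> D2 (X v) = X (D2 v)"
    using insert.IH[OF _ _ form_comp[OF insert.prems(3) lin_psi[OF A(1), of p]]] insert.prems by auto
  let ?D = "\<lambda>v. D1 (?d (?c v)) + D2 (?d v)"
  have "lin ?D"
    using D1(1) D2(1) A by (intro linI) (simp_all add: psi_simps lin_add lin_scale scale_right_distrib)
  moreover have "?D v = smul V (f v) (vac V)" if v: "v \<in> word_span (insert x N) {} False" for v
  proof -
    obtain u u' where u: "u \<in> word_span N {} False" "u' \<in> word_span N {} False" "v = u + ?c u'"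
      using creation_span_insert[OF insert.prems(1) v] by (auto simp: x act_def)
    have k: "?d u = 0" "?d u' = 0"
      using dual_letter_kills[OF A(4)] insert.prems insert.hyps u x by auto
    have dc: "?d (?c w) = w - ?c (?d w)" for w
      using psi_anticommute[OF A(1,1), of "-1 - p" p w] by simp
    have "2 * p \<noteq> -1" by presburger
    then have "?c v = ?c u" using u(3) A psi_square by (simp add: psi_simps)
    then have "?d (?c v) = u" using dc[of u] k A by (simp add: psi_simps)
    moreover have "?d v = u'" using dc[of u'] k A u(3) by (simp add: psi_simps)
    ultimately show ?thesis
      using D1(2)[OF u(1)] D2(2)[OF u(2)] u(3) form_add[OF insert.prems(3)]
      by (simp add: scale_left_distrib)
  qed
  moreover have "?D (X v) = X (?D v)"
    if "lin X" "\<forall>A\<in>S. \<forall>p v. X (psi A p v) = psi A p (X v)" for X v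
    using D1(3)[OF that] D2(3)[OF that] that A(3) by (simp add: lin_add) metis
  ultimately show ?case by (intro exI[of _ ?D]) blast
qed

section \<open>The tensor product of the factors\<close>

definition factor :: "nat \<Rightarrow> 'v set" where
  "factor j = word_span (column j \<times> UNIV) UNIV False"

text \<open>
  The vector \<open>v\<close> is kept as a parameter because a factor can be moved to the innermost position, where \<open>a\<^sub>(\<^sub>-\<^sub>1\<^sub>) vac = a\<close>
  makes it directly accessible to operators and to linearity.
\<close>

definition iterated_product :: "nat list \<Rightarrow> (nat \<Rightarrow> 'v) \<Rightarrow> 'v \<Rightarrow> 'v" where
  "iterated_product js a v = foldr (\<lambda>j. mode V (a j) (-1)) js v"

definition tensor_list :: "nat list \<Rightarrow> (nat \<Rightarrow> 'v) \<Rightarrow> 'v" where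
  "tensor_list js a = iterated_product js a (vac V)"

lemma iterated_product_simps [simp]:
  "iterated_product [] a v = v" "iterated_product (j # js) a v = mode V (a j) (-1) (iterated_product js a v)"
  by (simp_all add: iterated_product_def)

lemma factor_subalgebra: "j \<in> {1..n} \<Longrightarrow> vertex_subalgebra V (factor j)"
  unfolding factor_def by (rule word_span_vertex_subalgebra[OF column_subset_labels])

lemma factor_even: "j \<in> {1..n} \<Longrightarrow> factor j \<subseteq> even_part V"
  unfolding factor_def even_part_eq_word_span using column_subset_labels[of j]
  by (intro word_span_mono) (auto simp: letters_def)

lemma psi_factor_commute:
  assumes "i \<in> {1..n}" "j \<in> {1..n}" "i \<noteq> j" "A \<in> column j" "a \<in> factor i"
  shows "psi A p (mode V a q c) = mode V a q (psi A p c)"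
proof (rule word_span_mode_commute[OF lin_psi column_subset_labels[OF assms(1)] assms(5)[unfolded factor_def], of A "-1"])
  show A: "A \<in> labels" using assms column_subset_labels by blast
  fix B r v assume "B \<in> column i"
  then show "psi A p (psi B r v) = smul V (- 1) (psi B r (psi A p v))"
    using psi_anticommute[OF A, of B p r v] column_subset_labels assms by (auto simp: column_def labels_def)
qed simp

lemma factor_commuting:
  assumes "i \<in> {1..n}" "j \<in> {1..n}" "i \<noteq> j" "a \<in> factor i" "b \<in> factor j"
  shows "commuting a b"
  unfolding commuting_def
proof (intro allI)
  fix p q c
  show "mode V a p (mode V b q c) = mode V b q (mode V a p c)"
    by (rule word_span_mode_commute[OF mode_linear_right column_subset_labels[OF assms(2)]
          assms(5)[unfolded factor_def], of 1])
       (use psi_factor_commute[OF assms(1-3) _ assms(4)] in simp_all)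
qed

lemma iterated_product_commute:
  assumes "\<And>i v. i \<in> set js \<Longrightarrow> X (mode V (a i) (-1) v) = mode V (a i) (-1) (X v)"
  shows "X (iterated_product js a v) = iterated_product js a (X v)"
  using assms by (induction js) auto

lemma iterated_product_cong: "(\<And>i. i \<in> set js \<Longrightarrow> a i = b i) \<Longrightarrow> iterated_product js a v = iterated_product js b v"
  by (induction js) auto

lemma lin_iterated_product: "lin (iterated_product js a)"
proof (induction js)
  case Nil
  then show ?case by (auto intro: linI)
next
  case (Cons j js)
  then show ?case using lin_comp[OF mode_linear_right Cons, of "a j" "-1"] by simp
qed

text \<open>
  The factors commute, so the \<open>j\<close>-th one can be applied first.
\<close>

lemma iterated_product_extract:
  assumes "distinct js" "j \<in> set js" "set js \<subseteq> {1..n}" "\<And>i. i \<in> set js \<Longrightarrow> a i \<in> factor i"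
  shows "iterated_product js a v = iterated_product (remove1 j js) a (mode V (a j) (-1) v)"
  using assms
proof (induction js)
  case (Cons i js)
  show ?case
  proof (cases "i = j")
    case True
    have "mode V (a j) (-1) (mode V (a k) (-1) v) = mode V (a k) (-1) (mode V (a j) (-1) v)"
      if "k \<in> set js" for k v
    proof -
      have "commuting (a j) (a k)"
        by (rule factor_commuting[of j k]) (use Cons.prems that True in auto)
      then show ?thesis by (simp add: commuting_def)
    qed
    then have "mode V (a j) (-1) (iterated_product js a v) = iterated_product js a (mode V (a j) (-1) v)"
      by (rule iterated_product_commute)
    then show ?thesis using True by simp
  next
    case False
    then show ?thesis using Cons by auto
  qed
qed simp

lemma tensor_list_update:
  assumes "distinct js" "j \<in> set js" "set js \<subseteq> {1..n}" "\<And>i. i \<in> set js \<Longrightarrow> i \<noteq> j \<Longrightarrow> a i \<in> factor i" "x \<in> factor j"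
  shows "tensor_list js (a(j := x)) = iterated_product (remove1 j js) a x"
proof -
  have "tensor_list js (a(j := x)) = iterated_product (remove1 j js) (a(j := x)) (mode V x (-1) (vac V))"
    unfolding tensor_list_def using assms iterated_product_extract[of js j "a(j := x)" "vac V"] by simp
  also have "\<dots> = iterated_product (remove1 j js) a x"
    using assms(1) by (simp add: creation) (rule iterated_product_cong, auto)
  finally show ?thesis .
qed

text \<open>
  An operator commuting with all other factors acts on the \<open>j\<close>-th entry alone.
\<close>

lemma tensor_list_apply:
  assumes "distinct js" "j \<in> set js" "set js \<subseteq> {1..n}" "\<And>i. i \<in> set js \<Longrightarrow> a i \<in> factor i"
    and X: "\<And>i x v. i \<in> {1..n} \<Longrightarrow> i \<noteq> j \<Longrightarrow> x \<in> factor i \<Longrightarrow> X (mode V x (-1) v) = mode V x (-1) (X v)"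
  shows "X (tensor_list js a) = iterated_product (remove1 j js) a (X (a j))"
proof -
  have "tensor_list js a = iterated_product (remove1 j js) a (a j)"
    using tensor_list_update[OF assms(1-3), of a "a j"] assms by simp
  also have "X \<dots> = iterated_product (remove1 j js) a (X (a j))"
  proof (rule iterated_product_commute)
    fix i v assume "i \<in> set (remove1 j js)"
    then have "i \<in> set js" "i \<noteq> j" using assms(1) by auto
    then show "X (mode V (a i) (-1) v) = mode V (a i) (-1) (X v)"
      using assms(3,4) by (intro X) auto
  qed
  finally show ?thesis .
qed

lemma tensor_list_vac: "(\<And>i. i \<in> set js \<Longrightarrow> a i = vac V) \<Longrightarrow> tensor_list js a = vac V"
  by (induction js) (auto simp: tensor_list_def creation)

lemma tensor_list_mem:
  assumes "vertex_subalgebra V W" "\<And>j. j \<in> set js \<Longrightarrow> a j \<in> W"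
  shows "tensor_list js a \<in> W"
  using assms(2) vertex_subalgebraD[OF assms(1)] by (induction js) (auto simp: tensor_list_def)

lemma tensor_list_even: "set js \<subseteq> {1..n} \<Longrightarrow> (\<And>j. j \<in> set js \<Longrightarrow> a j \<in> factor j) \<Longrightarrow> tensor_list js a \<in> even_part V"
  using factor_even by (intro tensor_list_mem even_part_vertex_subalgebra) blast

lemma tensor_list_commuting:
  assumes "j \<in> {1..n}" "x \<in> factor j" "set js \<subseteq> {1..n} - {j}" "\<And>i. i \<in> set js \<Longrightarrow> a i \<in> factor i"
  shows "commuting x (tensor_list js a)"
  using assms(3,4)
proof (induction js)
  case Nil
  then show ?case by (simp add: tensor_list_def commuting_vac)
next
  case (Cons i js)
  have "commuting x (a i)" using factor_commuting[of j i x "a i"] assms(1,2) Cons.prems by auto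
  moreover have "commuting x (tensor_list js a)" using Cons by auto
  moreover have "a i \<in> even_part V" using Cons.prems factor_even[of i] by auto
  moreover have "tensor_list js a \<in> even_part V" using Cons.prems by (intro tensor_list_even) auto
  ultimately have "commuting x (mode V (a i) (-1) (tensor_list js a))" by (rule commuting_mode)
  then show ?case by (simp add: tensor_list_def)
qed

abbreviation mode_term where
  "mode_term js a b q p \<equiv>
    (if p \<in> extensional (set js) \<and> (\<Sum>j\<in>set js. p j + 1) = q + 1
     then tensor_list js (\<lambda>j. mode V (a j) (p j) (b j)) else 0)"

lemma tensor_list_zero: "j \<in> set js \<Longrightarrow> a j = 0 \<Longrightarrow> tensor_list js a = 0"
proof (induction js)
  case (Cons i js)
  then show ?case
    by (auto simp: tensor_list_def mode_left_simps mode_right_simps)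
qed simp

lemma mode_term_finite: "finite {p. mode_term js a b q p \<noteq> 0}"
proof -
  have "\<exists>N. \<forall>j\<in>set js. \<forall>p\<ge>N. mode V (a j) p (b j) = 0"
  proof (induction js)
    case (Cons j js)
    then obtain N where "\<forall>j\<in>set js. \<forall>p\<ge>N. mode V (a j) p (b j) = 0" by blast
    moreover obtain M where "\<forall>p\<ge>M. mode V (a j) p (b j) = 0" using truncation by blast
    ultimately show ?case by (intro exI[of _ "max N M"]) auto
  qed simp
  then obtain N where N: "\<And>j p. j \<in> set js \<Longrightarrow> p \<ge> N \<Longrightarrow> mode V (a j) p (b j) = 0" by blast
  have "{p. mode_term js a b q p \<noteq> 0}
    \<subseteq> {p \<in> extensional (set js). (\<Sum>j\<in>set js. p j + 1) = q + 1 \<and> (\<forall>j\<in>set js. p j < N)}"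
  proof
    fix p assume p: "p \<in> {p. mode_term js a b q p \<noteq> 0}"
    then have "tensor_list js (\<lambda>j. mode V (a j) (p j) (b j)) \<noteq> 0" by (auto split: if_splits)
    then have "p j < N" if "j \<in> set js" for j
      using N[OF that, of "p j"] tensor_list_zero[OF that] by (meson not_le)
    then show "p \<in> {p \<in> extensional (set js). (\<Sum>j\<in>set js. p j + 1) = q + 1 \<and> (\<forall>j\<in>set js. p j < N)}"
      using p by (auto split: if_splits)
  qed
  then show ?thesis using finite_mode_indices[of "set js"] finite_subset by blast
qed

text \<open>
  Induction on the list.  The step splits off the index \<open>s = p\<^sub>j\<close> by \<open>commuting_product_mode\<close> and merges
  it with an index \<open>p'\<close> for the rest of the list into \<open>p'(j := s)\<close>; the conditions on the
  sums match because \<open>(s + 1) + (q - 1 - s + 1) = q + 1\<close>.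
\<close>

lemma tensor_list_mode:
  assumes "distinct js" "set js \<subseteq> {1..n}"
    and "\<And>j. j \<in> set js \<Longrightarrow> a j \<in> factor j" "\<And>j. j \<in> set js \<Longrightarrow> b j \<in> factor j"
  shows "mode V (tensor_list js a) q (tensor_list js b) = Sum_any (mode_term js a b q)"
  using assms
proof (induction js arbitrary: q)
  case Nil
  have "Sum_any (mode_term [] a b q) = mode_term [] a b q (\<lambda>_. undefined)"
    by (rule Sum_any_single) (auto simp: fun_eq_iff)
  then show ?case by (auto simp: tensor_list_def vacuum)
next
  case (Cons j js)
  let ?v = "tensor_list js a" and ?w = "tensor_list js b"
  have j: "j \<in> {1..n}" "j \<notin> set js" "a j \<in> factor j" "b j \<in> factor j" and js: "set js \<subseteq> {1..n} - {j}"
    and ab: "\<And>i. i \<in> set js \<Longrightarrow> a i \<in> factor i" "\<And>i. i \<in> set js \<Longrightarrow> b i \<in> factor i"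
    using Cons.prems by auto
  have closed: "mode V (a j) s (b j) \<in> factor j" for s
    using vertex_subalgebraD(3)[OF factor_subalgebra[OF j(1)] j(3,4)] .
  define F where "F = mode_term (j # js) a b q"
  define H where "H s p' = mode V (mode V (a j) s (b j)) (-1) (mode_term js a b (q - 1 - s) p')" for s p'
  define ext where "ext = (\<lambda>(s, p'). p'(j := s) :: nat \<Rightarrow> int)"
  let ?E = "UNIV \<times> extensional (set js) :: (int \<times> (nat \<Rightarrow> int)) set"
  have H_F: "H s p' = F (p'(j := s))" if "p' \<in> extensional (set js)" for s p'
  proof -
    have "p'(j := s) \<in> extensional (insert j (set js))" using that by (auto simp: extensional_def)
    moreover have "(\<Sum>i\<in>insert j (set js). (p'(j := s)) i + 1) = s + 1 + (\<Sum>i\<in>set js. p' i + 1)"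
      using j(2) by (simp, intro sum.cong) auto
    moreover have "tensor_list js (\<lambda>i. mode V (a i) ((p'(j := s)) i) (b i)) = tensor_list js (\<lambda>i. mode V (a i) (p' i) (b i))"
      unfolding tensor_list_def using j(2) by (intro iterated_product_cong) auto
    ultimately show ?thesis
      using that by (auto simp: H_def F_def tensor_list_def mode_right_simps)
  qed
  have H_0: "H s p' = 0" if "p' \<notin> extensional (set js)" for s p'
    using that by (simp add: H_def mode_right_simps)
  have inj: "inj_on ext ?E"
  proof (rule inj_onI, clarsimp simp: ext_def)
    fix s p' t r' assume *: "p' \<in> extensional (set js)" "r' \<in> extensional (set js)" "p'(j := s) = r'(j := t)"
    have "p' i = r' i" for i
      using fun_cong[OF *(3), of i] *(1,2) j(2) by (cases "i = j") (auto simp: extensional_def)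
    then show "s = t \<and> p' = r'" using fun_cong[OF *(3), of j] by auto
  qed
  have Ffin: "finite {p. F p \<noteq> 0}" unfolding F_def by (rule mode_term_finite)
  define Z where "Z = {(s, p'). H s p' \<noteq> 0}"
  have ZE: "Z \<subseteq> ?E" using H_0 by (auto simp: Z_def)
  have img: "ext ` Z = {p. F p \<noteq> 0}"
  proof safe
    fix s p' assume "(s, p') \<in> Z" "F (ext (s, p')) = 0"
    moreover from this have "p' \<in> extensional (set js)" using ZE by blast
    ultimately show False using H_F[of p' s] by (simp add: Z_def ext_def)
  next
    fix p assume p: "F p \<noteq> 0"
    define p' where "p' = restrict p (set js)"
    have "p \<in> extensional (set (j # js))" using p by (auto simp: F_def split: if_splits)
    then have "p'(j := p j) = p" by (auto simp: p'_def extensional_def fun_eq_iff)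
    moreover from this have "H (p j) p' = F p" using H_F[of p' "p j"] by (simp add: p'_def)
    ultimately show "p \<in> ext ` Z" using p by (intro image_eqI[of _ _ "(p j, p')"]) (auto simp: ext_def Z_def)
  qed
  have Zfin: "finite Z"
    using finite_imageD[OF _ inj_on_subset[OF inj ZE]] img Ffin by simp
  have "mode V (tensor_list (j # js) a) q (tensor_list (j # js) b)
    = Sum_any (\<lambda>s. mode V (mode V (a j) s (b j)) (-1) (mode V ?v (q - 1 - s) ?w))"
  proof -
    have "mode V (mode V (a j) (-1) ?v) q (mode V (b j) (-1) ?w)
      = Sum_any (\<lambda>s. mode V (mode V (a j) s (b j)) (-1) (mode V ?v (q - 1 - s) ?w))"
      by (rule commuting_product_mode)
         (use j js ab factor_even[OF j(1)] closed in \<open>auto intro!: tensor_list_commuting[OF j(1)] tensor_list_even\<close>)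
    then show ?thesis by (simp add: tensor_list_def)
  qed
  also have "\<dots> = Sum_any (\<lambda>s. Sum_any (H s))"
  proof -
    have "mode V ?v (q - 1 - s) ?w = Sum_any (mode_term js a b (q - 1 - s))" for s
      using Cons.IH[of "q - 1 - s"] Cons.prems by simp
    moreover have "mode V x (-1) (Sum_any (mode_term js a b r))
        = Sum_any (\<lambda>p'. mode V x (-1) (mode_term js a b r p'))" for x r
      by (rule lin_Sum_any[OF mode_linear_right mode_term_finite])
    ultimately show ?thesis by (simp only: H_def[abs_def])
  qed
  also have "\<dots> = Sum_any (\<lambda>(s, p'). H s p')"
  proof (rule Sum_any.cartesian_product)
    show "finite (fst ` Z \<times> snd ` Z)" using Zfin by simp
    show "{s. \<exists>p'. H s p' \<noteq> 0} \<times> {p'. \<exists>s. H s p' \<noteq> 0} \<subseteq> fst ` Z \<times> snd ` Z"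
      by (force simp: Z_def)
  qed
  also have "\<dots> = (\<Sum>z\<in>Z. F (ext z))"
  proof -
    have "Sum_any (\<lambda>(s, p'). H s p') = (\<Sum>(s, p')\<in>Z. H s p')"
      using Zfin by (intro Sum_any.expand_superset) (auto simp: Z_def)
    also have "\<dots> = (\<Sum>z\<in>Z. F (ext z))"
      using ZE H_F by (intro sum.cong) (auto simp: ext_def)
    finally show ?thesis .
  qed
  also have "\<dots> = (\<Sum>p\<in>{p. F p \<noteq> 0}. F p)"
    using sum.reindex[OF inj_on_subset[OF inj ZE], of F] img by simp
  also have "\<dots> = Sum_any F" by (simp add: Sum_any.expand_set)
  finally show ?case by (simp only: F_def)
qed

definition factors :: "nat list" where
  "factors = [1..<Suc n]"

lemma set_factors: "set factors = {1..n}"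
  by (auto simp: factors_def)

lemma distinct_factors: "distinct factors"
  by (simp add: factors_def)

abbreviation tensor :: "(nat \<Rightarrow> 'v) \<Rightarrow> 'v" where
  "tensor \<equiv> tensor_list factors"

lemma tensor_update:
  assumes "a \<in> Pi\<^sub>E {1..n} factor" "j \<in> {1..n}" "x \<in> factor j"
  shows "tensor (a(j := x)) = iterated_product (remove1 j factors) a x"
  using assms by (intro tensor_list_update distinct_factors) (auto simp: PiE_def set_factors)

lemma tensor_apply:
  assumes "a \<in> Pi\<^sub>E {1..n} factor" "j \<in> {1..n}"
    and X: "\<And>i x v. i \<in> {1..n} \<Longrightarrow> i \<noteq> j \<Longrightarrow> x \<in> factor i \<Longrightarrow> X (mode V x (-1) v) = mode V x (-1) (X v)"
  shows "X (tensor a) = iterated_product (remove1 j factors) a (X (a j))"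
  using assms by (intro tensor_list_apply distinct_factors) (auto simp: PiE_def set_factors)

lemma tensor_multilinear: "multilinear_on (smul V) (smul V) {1..n} factor tensor"
  unfolding multilinear_on_def
proof (intro ballI allI)
  fix a j x y c assume a: "a \<in> Pi\<^sub>E {1..n} factor" and j: "j \<in> {1..n}" and xy: "x \<in> factor j" "y \<in> factor j"
  have sub: "subspace (factor j)" by (rule vertex_subalgebraD(1)[OF factor_subalgebra[OF j]])
  show "tensor (a(j := x + y)) = tensor (a(j := x)) + tensor (a(j := y)) \<and>
      tensor (a(j := smul V c x)) = smul V c (tensor (a(j := x)))"
    using tensor_update[OF a j] xy subspace_add[OF sub xy] subspace_scale[OF sub xy(1)]
      lin_add[OF lin_iterated_product] lin_scale[OF lin_iterated_product] by simp
qed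

lemma vac_factor: "j \<in> {1..n} \<Longrightarrow> vac V \<in> factor j"
  using vertex_subalgebraD(2)[OF factor_subalgebra] .

lemma PiE_update: "a \<in> Pi\<^sub>E {1..n} factor \<Longrightarrow> j \<in> {1..n} \<Longrightarrow> x \<in> factor j \<Longrightarrow> a(j := x) \<in> Pi\<^sub>E {1..n} factor"
  by (auto simp: PiE_def extensional_def Pi_def)

lemma tensor_vac: "tensor (\<lambda>j\<in>{1..n}. vac V) = vac V"
  by (rule tensor_list_vac) (auto simp: set_factors)

lemma PiE_vac: "(\<lambda>j\<in>{1..n}. vac V) \<in> Pi\<^sub>E {1..n} factor"
  using vac_factor by auto

lemma tensor_single:
  assumes "j \<in> {1..n}" "x \<in> factor j"
  shows "tensor (\<lambda>i\<in>{1..n}. if i = j then x else vac V) = x"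
proof -
  have "(\<lambda>i\<in>{1..n}. if i = j then x else vac V) = (\<lambda>i\<in>{1..n}. vac V)(j := x)"
    using assms(1) by (auto simp: fun_eq_iff)
  then have "tensor (\<lambda>i\<in>{1..n}. if i = j then x else vac V) = tensor ((\<lambda>i\<in>{1..n}. vac V)(j := x))"
    by (rule arg_cong)
  also have "\<dots> = iterated_product (remove1 j factors) (\<lambda>i\<in>{1..n}. vac V) x"
    by (rule tensor_update[OF PiE_vac assms])
  also have "\<dots> = x"
  proof -
    have "iterated_product js (\<lambda>i\<in>{1..n}. vac V) x = x" if "set js \<subseteq> {1..n}" for js
      using that by (induction js) (auto simp: vacuum)
    moreover have "set (remove1 j factors) \<subseteq> {1..n}"
      using set_remove1_subset[of j factors] set_factors by blast
    ultimately show ?thesis by blast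
  qed
  finally show ?thesis .
qed

text \<open>
  The span of the tensors is closed under pairs of letters of one column, because such a pair
  acts on a single entry, preserving its factor.  Hence it contains all words that are even in every column.
\<close>

lemma tensor_span:
  assumes W: "W = fixed_points (even_part V) (flip_aut ` {1..n})" "vertex_subalgebra V W"
    and L: "\<And>j. j \<in> {1..n} \<Longrightarrow> factor j \<subseteq> W"
  shows "span (tensor ` Pi\<^sub>E {1..n} factor) = W"
proof
  show "span (tensor ` Pi\<^sub>E {1..n} factor) \<subseteq> W"
  proof (rule span_minimal[OF _ vertex_subalgebraD(1)[OF W(2)]], safe)
    fix a assume "a \<in> Pi\<^sub>E {1..n} factor"
    then show "tensor a \<in> W" using L by (intro tensor_list_mem[OF W(2)]) (unfold set_factors, blast)
  qed
  let ?T = "span (tensor ` Pi\<^sub>E {1..n} factor)"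
  show "W \<subseteq> ?T"
  proof
    fix v assume "v \<in> W"
    then have "v \<in> span (word ` even_words {1..n})"
      unfolding W(1) by (intro fixed_in_even_words) (auto simp: fixed_points_def flip_aut_def)
    moreover have "span (word ` even_words {1..n}) \<subseteq> ?T"
    proof (rule span_minimal[OF _ subspace_span], safe)
      fix w assume w: "w \<in> even_words {1..n}"
      show "word w \<in> ?T"
      proof (rule even_word_mem[OF subspace_span _ _ w])
        show "vac V \<in> ?T" by (rule span_base) (rule image_eqI[where f = tensor, OF tensor_vac[symmetric] PiE_vac])
        fix j A B p q v
        assume j: "j \<in> {1..n}" and AB: "A \<in> column j" "B \<in> column j" and v: "v \<in> ?T"
        have idx: "A \<in> labels" "B \<in> labels" using AB column_subset_labels[OF j] by auto
        show "psi A p (psi B q v) \<in> ?T"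
        proof (rule lin_span_subset[where X = "\<lambda>v. psi A p (psi B q v)",
              OF lin_comp[OF lin_psi[OF idx(1)] lin_psi[OF idx(2)]] _ subspace_span v])
          fix x assume "x \<in> tensor ` Pi\<^sub>E {1..n} factor"
          then obtain a where a: "x = tensor a" "a \<in> Pi\<^sub>E {1..n} factor" by auto
          let ?y = "psi A p (psi B q (a j))"
          have "a j \<in> factor j" using a j by auto
          moreover have "column j \<times> UNIV \<subseteq> letters" using column_subset_labels[OF j] by (auto simp: letters_def)
          ultimately have y: "?y \<in> factor j"
            using act_word_span[of "(A, p)" "column j \<times> UNIV" _ UNIV True] act_word_span[of "(B, q)" "column j \<times> UNIV" "a j" UNIV False] AB
            by (simp add: act_def factor_def)
          have "psi A p (psi B q (tensor a)) = iterated_product (remove1 j factors) a ?y"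
            using tensor_apply[OF a(2) j, of "\<lambda>v. psi A p (psi B q v)"] psi_factor_commute[OF _ j _ AB(1)]
              psi_factor_commute[OF _ j _ AB(2)] by simp
          also have "\<dots> = tensor (a(j := ?y))"
            by (rule tensor_update[OF a(2) j y, symmetric])
          finally show "psi A p (psi B q x) \<in> ?T"
            using PiE_update[OF a(2) j y] a(1) by (auto intro: span_base)
        qed
      qed
    qed
    ultimately show "v \<in> ?T" by blast
  qed
qed

lemma finite_subset_factor_creation:
  assumes "j \<in> {1..n}" "finite F" "F \<subseteq> factor j"
  shows "\<exists>N. finite N \<and> N \<subseteq> creations \<and> N \<subseteq> column j \<times> UNIV \<and> F \<subseteq> word_span N {} False"
  using assms(2,3)
proof (induction F)
  case empty
  then show ?case by (intro exI[of _ "{}"]) auto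
next
  case (insert v F)
  then obtain N where N: "finite N" "N \<subseteq> creations" "N \<subseteq> column j \<times> UNIV" "F \<subseteq> word_span N {} False" by auto
  have "column j \<times> UNIV \<subseteq> letters" using column_subset_labels[OF assms(1)] by (auto simp: letters_def)
  moreover have "v \<in> word_span (column j \<times> UNIV) UNIV False" using insert by (simp add: factor_def)
  ultimately obtain M where M: "finite M" "M \<subseteq> column j \<times> UNIV \<inter> creations" "v \<in> word_span M UNIV False"
    by (rule word_span_finite_creation)
  have "word_span M UNIV False \<subseteq> word_span M {} False"
    by (intro word_span_subset word_span_subspace word_in_word_span) auto
  then have "v \<in> word_span (M \<union> N) {} False" using M(3) word_span_mono[of M "M \<union> N" "{}" False] by auto
  moreover have "F \<subseteq> word_span (M \<union> N) {} False" using N(4) word_span_mono[of N "M \<union> N" "{}" False] by auto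
  ultimately show ?case using M N by (intro exI[of _ "M \<union> N"]) auto
qed

lemma factor_functional_operator:
  assumes "j \<in> {1..n}" "finite F" "F \<subseteq> factor j" "form f"
  shows "\<exists>D. lin D \<and> (\<forall>v\<in>F. D v = smul V (f v) (vac V)) \<and>
    (\<forall>i\<in>{1..n}. i \<noteq> j \<longrightarrow> (\<forall>x\<in>factor i. \<forall>v. D (mode V x (-1) v) = mode V x (-1) (D v)))"
proof -
  obtain N where N: "finite N" "N \<subseteq> creations" "N \<subseteq> column j \<times> UNIV" "F \<subseteq> word_span N {} False"
    using finite_subset_factor_creation[OF assms(1-3)] by blast
  obtain D where D: "lin D" "\<And>v. v \<in> word_span N {} False \<Longrightarrow> D v = smul V (f v) (vac V)"
    "\<And>X v. lin X \<Longrightarrow> (\<forall>A\<in>column j. \<forall>p v. X (psi A p v) = psi A p (X v)) \<Longrightarrow> D (X v) = X (D v)"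
    using density[OF N(1-3) assms(4)] by blast
  have "D (mode V x (-1) v) = mode V x (-1) (D v)"
    if "i \<in> {1..n}" "i \<noteq> j" "x \<in> factor i" for i x v
    using D(3)[OF mode_linear_right, of x "-1" v] psi_factor_commute[OF that(1) assms(1) that(2) _ that(3)] by simp
  then show ?thesis using D(1,2) N(4) by (intro exI[of _ D]) blast
qed

text \<open>
  Let \<open>f\<^sub>j\<close> be the linear form that is \<open>1\<close> on the \<open>j\<close>-th entry of \<open>b0\<close> and \<open>0\<close> on the other vectors of \<open>B j\<close>.  The
  composition of the operators realizing the \<open>f\<^sub>j\<close> multiplies the vacuum by \<open>\<Prod>\<^sub>j f\<^sub>j(b\<^sub>j)\<close> when applied
  to the tensor of \<open>b\<close>.
\<close>

lemma separating_operator: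
  assumes B: "\<And>j. j \<in> {1..n} \<Longrightarrow> B j \<subseteq> factor j \<and> independent (B j)"
    and b0: "b0 \<in> Pi\<^sub>E {1..n} B" and F: "finite F" "F \<subseteq> Pi\<^sub>E {1..n} B"
  shows "\<exists>E. lin E \<and> E (tensor b0) = vac V \<and> (\<forall>b\<in>F - {b0}. E (tensor b) = 0)"
proof -
  have "\<exists>f. form f \<and> (\<forall>x\<in>B j. f x = (if x = b0 j then 1 else 0))" if "j \<in> {1..n}" for j
    using form_extend[of "B j" "\<lambda>x. if x = b0 j then 1 else 0"] B[OF that] by simp
  then obtain f where f: "\<And>j. j \<in> {1..n} \<Longrightarrow> form (f j)"
    "\<And>j x. j \<in> {1..n} \<Longrightarrow> x \<in> B j \<Longrightarrow> f j x = (if x = b0 j then 1 else 0)" by metis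
  let ?F = "insert b0 F"
  have mem: "b j \<in> B j" if "b \<in> ?F" "j \<in> {1..n}" for b j
    using that b0 F(2) PiE_mem by blast
  then have FL: "b \<in> Pi\<^sub>E {1..n} factor" if "b \<in> ?F" for b
    using that b0 F B by (intro PiE_I) (blast, auto simp: PiE_def extensional_def)
  have "\<exists>D. lin D \<and> (\<forall>v\<in>(\<lambda>b. b j) ` ?F. D v = smul V (f j v) (vac V)) \<and>
    (\<forall>i\<in>{1..n}. i \<noteq> j \<longrightarrow> (\<forall>x\<in>factor i. \<forall>v. D (mode V x (-1) v) = mode V x (-1) (D v)))"
    if j: "j \<in> {1..n}" for j
  proof (rule factor_functional_operator[OF j _ _ f(1)[OF j]])
    show "(\<lambda>b. b j) ` ?F \<subseteq> factor j" using mem j B[OF j] by blast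
  qed (use F in auto)
  then obtain D where D: "\<And>j. j \<in> {1..n} \<Longrightarrow> lin (D j)"
    "\<And>j b. j \<in> {1..n} \<Longrightarrow> b \<in> ?F \<Longrightarrow> D j (b j) = smul V (f j (b j)) (vac V)"
    "\<And>j i x v. j \<in> {1..n} \<Longrightarrow> i \<in> {1..n} \<Longrightarrow> i \<noteq> j \<Longrightarrow> x \<in> factor i \<Longrightarrow> D j (mode V x (-1) v) = mode V x (-1) (D j v)"
    by (metis (lifting) image_eqI)
  have lin: "lin (foldr D js)" if "set js \<subseteq> {1..n}" for js
    using that
  proof (induction js)
    case Nil
    then show ?case by (auto intro: linI)
  next
    case (Cons j js)
    then show ?case using lin_comp[OF D(1) Cons.IH, of j] by (simp add: comp_def)
  qed
  have step: "foldr D js (tensor b) =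
      smul V (\<Prod>j\<in>set js. f j (b j)) (tensor (\<lambda>i. if i \<in> set js then vac V else b i))"
    if "b \<in> ?F" "distinct js" "set js \<subseteq> {1..n}" for b js
    using that(2,3)
  proof (induction js)
    case Nil
    then show ?case by simp
  next
    case (Cons j js)
    let ?b = "\<lambda>i. if i \<in> set js then vac V else b i"
    have j: "j \<in> {1..n}" "j \<notin> set js" using Cons.prems by auto
    have b: "?b \<in> Pi\<^sub>E {1..n} factor"
      using FL[OF that(1)] vac_factor Cons.prems by (auto simp: PiE_def extensional_def Pi_def)
    have "D j (tensor ?b) = iterated_product (remove1 j factors) ?b (D j (?b j))"
      using D(3)[OF j(1)] by (intro tensor_apply[OF b j(1)]) auto
    also have "\<dots> = smul V (f j (b j)) (iterated_product (remove1 j factors) ?b (vac V))"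
      using D(2)[OF j(1) that(1)] j(2) by (simp add: lin_scale[OF lin_iterated_product])
    also have "iterated_product (remove1 j factors) ?b (vac V) = tensor (?b(j := vac V))"
      by (rule tensor_update[OF b j(1) vac_factor[OF j(1)], symmetric])
    also have "?b(j := vac V) = (\<lambda>i. if i \<in> set (j # js) then vac V else b i)"
      by (auto simp: fun_eq_iff)
    finally show ?case
      using Cons j by (simp add: lin_scale[OF D(1)[OF j(1)]] mult.commute)
  qed
  define E where "E = foldr D factors"
  have E: "E (tensor b) = smul V (\<Prod>j\<in>{1..n}. f j (b j)) (vac V)" if "b \<in> ?F" for b
  proof -
    have "tensor (\<lambda>i. if i \<in> {1..n} then vac V else b i) = vac V"
      by (rule tensor_list_vac) (simp add: set_factors)
    then show ?thesis
      using step[OF that distinct_factors] unfolding set_factors E_def by simp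
  qed
  have "lin E" unfolding E_def by (rule lin) (simp add: set_factors)
  moreover have "E (tensor b0) = vac V"
    using E[of b0] f(2) mem by simp
  moreover have "E (tensor b) = 0" if b: "b \<in> F - {b0}" for b
  proof -
    have "b \<in> extensional {1..n}" "b0 \<in> extensional {1..n}" using b F b0 by (auto simp: PiE_def)
    then obtain j where j: "j \<in> {1..n}" "b j \<noteq> b0 j"
      using b extensionalityI[of b "{1..n}" b0] by blast
    then have "f j (b j) = 0" using f(2)[OF j(1) mem[OF _ j(1), of b]] b by auto
    then have "(\<Prod>j\<in>{1..n}. f j (b j)) = 0" using j(1) by (intro prod_zero) auto
    then show ?thesis using E[of b] b by simp
  qed
  ultimately show ?thesis by blast
qed

lemma tensor_basis_independent:
  assumes B: "\<And>j. j \<in> {1..n} \<Longrightarrow> B j \<subseteq> factor j \<and> independent (B j)"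
  shows "inj_on tensor (Pi\<^sub>E {1..n} B)" "independent (tensor ` Pi\<^sub>E {1..n} B)"
proof -
  show inj: "inj_on tensor (Pi\<^sub>E {1..n} B)"
  proof (rule inj_onI, rule ccontr)
    fix b b' assume b: "b \<in> Pi\<^sub>E {1..n} B" "b' \<in> Pi\<^sub>E {1..n} B" "tensor b = tensor b'" "b \<noteq> b'"
    obtain E where "E (tensor b) = vac V" "E (tensor b') = 0"
      using separating_operator[OF B b(1), of "{b'}"] b by auto
    then show False using b vac_nonzero by simp
  qed
  show "independent (tensor ` Pi\<^sub>E {1..n} B)"
    unfolding independent_explicit_module
  proof (intro allI impI)
    fix T u v assume T: "finite T" "T \<subseteq> tensor ` Pi\<^sub>E {1..n} B"
      and sum: "(\<Sum>v\<in>T. smul V (u v) v) = 0" and v: "v \<in> T"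
    obtain F where F: "F \<subseteq> Pi\<^sub>E {1..n} B" "finite F" "T = tensor ` F"
      using finite_subset_image[OF T] by blast
    obtain b0 where b0: "b0 \<in> F" "v = tensor b0" using v F by blast
    obtain E where E: "lin E" "E (tensor b0) = vac V" "\<And>b. b \<in> F - {b0} \<Longrightarrow> E (tensor b) = 0"
      using separating_operator[OF B, of b0 F] F b0 by blast
    have "0 = E (\<Sum>v\<in>T. smul V (u v) v)" using sum lin_zero[OF E(1)] by simp
    also have "\<dots> = (\<Sum>x\<in>T. smul V (u x) (E x))"
      by (simp add: lin_sum[OF E(1)] lin_scale[OF E(1)])
    also have "\<dots> = (\<Sum>x\<in>T. if x = v then smul V (u v) (vac V) else 0)"
    proof (rule sum.cong[OF refl])
      fix x assume "x \<in> T"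
      then obtain b where "b \<in> F" "x = tensor b" using F(3) by blast
      then show "smul V (u x) (E x) = (if x = v then smul V (u v) (vac V) else 0)"
        using E(2) E(3)[of b] b0 by (cases "b = b0") auto
    qed
    also have "\<dots> = smul V (u v) (vac V)" using T(1) v by simp
    finally show "u v = 0" using vac_nonzero by simp
  qed
qed

text \<open>
  Prescribe the form on tensors of basis vectors, which are linearly independent, and replace the basis
  vectors by arbitrary elements of the factors one entry at a time, using multilinearity.
\<close>

lemma tensor_universal:
  assumes \<phi>: "multilinear_on (smul V) (*) {1..n} factor \<phi>"
  shows "\<exists>f. form f \<and> (\<forall>a\<in>Pi\<^sub>E {1..n} factor. f (tensor a) = \<phi> a)"
proof -
  have "\<forall>j. \<exists>B. B \<subseteq> factor j \<and> independent B \<and> factor j \<subseteq> span B"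
  proof
    fix j
    obtain B where "B \<subseteq> factor j" "independent B" "factor j \<subseteq> span B"
      by (rule maximal_independent_subset)
    then show "\<exists>B. B \<subseteq> factor j \<and> independent B \<and> factor j \<subseteq> span B" by blast
  qed
  then obtain B where "\<forall>j. B j \<subseteq> factor j \<and> independent (B j) \<and> factor j \<subseteq> span (B j)"
    by (rule choice[THEN exE])
  then have B: "\<And>j. B j \<subseteq> factor j" "\<And>j. independent (B j)" "\<And>j. factor j \<subseteq> span (B j)"
    by simp_all
  have BL: "B j \<subseteq> factor j \<and> independent (B j)" for j using B by simp
  have inj: "inj_on tensor (Pi\<^sub>E {1..n} B)" by (rule tensor_basis_independent(1)[OF BL])
  have ind: "independent (tensor ` Pi\<^sub>E {1..n} B)" by (rule tensor_basis_independent(2)[OF BL])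
  obtain f where f: "form f"
    "\<forall>x\<in>tensor ` Pi\<^sub>E {1..n} B. f x = \<phi> (inv_into (Pi\<^sub>E {1..n} B) tensor x)"
    using form_extend[OF ind, of "\<lambda>x. \<phi> (inv_into (Pi\<^sub>E {1..n} B) tensor x)"] by (elim exE conjE)
  have agree: "f (tensor a) = \<phi> a"
    if "finite J" "J \<subseteq> {1..n}" "a \<in> Pi\<^sub>E {1..n} factor" "\<And>j. j \<in> {1..n} - J \<Longrightarrow> a j \<in> B j" for J a
    using that
  proof (induction J arbitrary: a)
    case empty
    then have "a \<in> Pi\<^sub>E {1..n} B" by (auto simp: PiE_def)
    then show ?case using f(2) inv_into_f_f[OF inj] by simp
  next
    case (insert j J)
    have j: "j \<in> {1..n}" using insert.prems by simp
    have sub: "subspace (factor j)" by (rule vertex_subalgebraD(1)[OF factor_subalgebra[OF j]])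
    have upd: "\<phi> (a(j := x + y)) = \<phi> (a(j := x)) + \<phi> (a(j := y)) \<and>
        \<phi> (a(j := smul V c x)) = c * \<phi> (a(j := x)) \<and>
        tensor (a(j := x + y)) = tensor (a(j := x)) + tensor (a(j := y)) \<and>
        tensor (a(j := smul V c x)) = smul V c (tensor (a(j := x)))"
      if "x \<in> factor j" "y \<in> factor j" for x y c
      using bspec[OF bspec[OF bspec[OF bspec[OF \<phi>[unfolded multilinear_on_def] insert.prems(2)] j] that(1)] that(2)]
        bspec[OF bspec[OF bspec[OF bspec[OF tensor_multilinear[unfolded multilinear_on_def] insert.prems(2)] j] that(1)] that(2)]
      by simp
    let ?S = "{x \<in> factor j. f (tensor (a(j := x))) = \<phi> (a(j := x))}"
    have add: "x + y \<in> ?S" if "x \<in> ?S" "y \<in> ?S" for x y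
      using that upd[of x y] subspace_add[OF sub, of x y] by (simp add: form_add[OF f(1)])
    have scale: "smul V c x \<in> ?S" if "x \<in> ?S" for c x
      using that upd[of x x c] subspace_scale[OF sub, of x c] by (simp add: form_scale[OF f(1)])
    have zero: "0 \<in> ?S"
    proof -
      have 0: "0 \<in> factor j" by (rule subspace_0[OF sub])
      have "\<phi> (a(j := 0)) = 0" "tensor (a(j := 0)) = 0" using upd[OF 0 0, of 0] by simp_all
      then show ?thesis using form_scale[OF f(1), of 0 0] 0 by simp
    qed
    have "B j \<subseteq> ?S"
    proof
      fix x assume x: "x \<in> B j"
      then have xL: "x \<in> factor j" using B(1) by blast
      have "f (tensor (a(j := x))) = \<phi> (a(j := x))"
        using insert.prems x by (intro insert.IH PiE_update[OF insert.prems(2) j xL]) auto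
      then show "x \<in> ?S" using xL by simp
    qed
    moreover have "subspace ?S" using add scale zero by (simp only: subspace_def) blast
    ultimately have "span (B j) \<subseteq> ?S" by (rule span_minimal)
    then have "a j \<in> ?S" using PiE_mem[OF insert.prems(2) j] B(3) by blast
    then show ?case by simp
  qed
  have "f (tensor a) = \<phi> a" if "a \<in> Pi\<^sub>E {1..n} factor" for a
    using agree[of "{1..n}" a] that by simp
  then show ?thesis using f(1) by blast
qed

lemma internal_tensor_product:
  assumes W: "W = fixed_points (even_part V) (flip_aut ` {1..n})" "vertex_subalgebra V W"
    and L: "\<And>j. j \<in> {1..n} \<Longrightarrow> factor j \<subseteq> W"
  shows "is_internal_tensor_product V {1..n} factor W"
proof -
  have "mode V (tensor a) q (tensor b) = Sum_any (\<lambda>p.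
      if p \<in> extensional {1..n} \<and> (\<Sum>j\<in>{1..n}. p j + 1) = q + 1
      then tensor (\<lambda>j\<in>{1..n}. mode V (a j) (p j) (b j)) else 0)"
    if "a \<in> Pi\<^sub>E {1..n} factor" "b \<in> Pi\<^sub>E {1..n} factor" for a b q
  proof -
    have "mode V (tensor a) q (tensor b) = Sum_any (mode_term factors a b q)"
      using that by (intro tensor_list_mode distinct_factors) (unfold set_factors, auto simp: PiE_def)
    moreover have "tensor (\<lambda>j\<in>{1..n}. mode V (a j) (p j) (b j)) = tensor (\<lambda>j. mode V (a j) (p j) (b j))" for p
      unfolding tensor_list_def by (rule iterated_product_cong) (simp add: set_factors)
    ultimately show ?thesis by (simp only: set_factors)
  qed
  then have "is_tensor_product (smul V) {1..n} factor W tensor \<and>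
      tensor (\<lambda>j\<in>{1..n}. vac V) = vac V \<and>
      (\<forall>j\<in>{1..n}. \<forall>x\<in>factor j. tensor (\<lambda>i\<in>{1..n}. if i = j then x else vac V) = x) \<and>
      (\<forall>a\<in>Pi\<^sub>E {1..n} factor. \<forall>b\<in>Pi\<^sub>E {1..n} factor. \<forall>q. mode V (tensor a) q (tensor b) = Sum_any (\<lambda>p.
        if p \<in> extensional {1..n} \<and> (\<Sum>j\<in>{1..n}. p j + 1) = q + 1
        then tensor (\<lambda>j\<in>{1..n}. mode V (a j) (p j) (b j)) else 0))"
    using tensor_multilinear tensor_span[OF W L] tensor_universal tensor_vac tensor_single
    by (simp only: is_tensor_product_def) blast
  then show ?thesis
    unfolding is_internal_tensor_product_def using factor_subalgebra factor_even W(2) by blast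
qed

end

section \<open>The fixed-point algebra as a tensor product\<close>

text \<open>
  The family of factors matters on the index set only; the family of word spans and the family of
  generated subalgebras agree there but not necessarily elsewhere.
\<close>

lemma tensor_product_cong:
  assumes "\<And>j. j \<in> I \<Longrightarrow> L j = M j"
  shows "is_internal_tensor_product V I L W \<longleftrightarrow> is_internal_tensor_product V I M W"
proof -
  have "Pi\<^sub>E I L = Pi\<^sub>E I M" using assms by (rule PiE_cong)
  then show ?thesis
    using assms
    by (simp add: is_internal_tensor_product_def is_tensor_product_def multilinear_on_def cong: ball_cong)
qed

theorem lemma4p9:
  fixes V :: "'v::ab_group_add vertex_data"
    and \<psi> :: "nat \<Rightarrow> nat \<Rightarrow> int \<Rightarrow> 'v \<Rightarrow> 'v"
    and m n :: nat
  assumes "m \<ge> 2" and "n \<ge> 3"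
    and "free_fermions V \<psi> (2 * m) n"
  shows "so_diagonal V \<psi> (2 * m) n
           \<subseteq> fixed_points (so_level_one V) (sigma_group V \<psi> (2 * m) n)
       \<and> fixed_points (so_level_one V) (sigma_group V \<psi> (2 * m) n)
           = generated_subalgebra V (\<Union>j\<in>{1..n}. so_level_one_factor V \<psi> (2 * m) j)
       \<and> is_internal_tensor_product V {1..n} (so_level_one_factor V \<psi> (2 * m))
           (fixed_points (so_level_one V) (sigma_group V \<psi> (2 * m) n))"
proof -
  interpret free_fermions V \<psi> "2 * m" n by (rule assms(3))
  have K: "2 * m \<ge> 3" using assms(1) by simp
  let ?F = "fixed_points (so_level_one V) (sigma_group V \<psi> (2 * m) n)"
  let ?L = "so_level_one_factor V \<psi> (2 * m)"
  let ?W = "generated_subalgebra V (\<Union>j\<in>{1..n}. ?L j)"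
  have F: "?F = fixed_points (even_part V) (flip_aut ` {1..n})"
    by (rule fixed_points_sigma_group[OF K])
  also have FW: "\<dots> = ?W" by (rule fixed_points_eq_generated[OF K])
  finally have "?F = ?W" .
  have W: "vertex_subalgebra V ?W" by (rule generated_subalgebra_vertex_subalgebra)
  have L: "?L j \<subseteq> ?W" if "j \<in> {1..n}" for j
    using generated_subalgebra_superset[of "\<Union>j\<in>{1..n}. ?L j"] that by blast
  have LL: "?L j = factor j" if "j \<in> {1..n}" for j
    unfolding factor_def by (rule factor_eq_word_span[OF K that])
  have "is_internal_tensor_product V {1..n} factor ?W"
    using L LL by (intro internal_tensor_product[OF FW[symmetric] W]) auto
  then have "is_internal_tensor_product V {1..n} ?L ?W"
    using tensor_product_cong[of "{1..n}" ?L factor] LL by blast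
  then show ?thesis
    using diagonal_subset[OF W L] \<open>?F = ?W\<close> by simp
qed

end
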